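(* Let $A'(x,y)=\sum_{P}x^{\mathrm{width}(P)}y^{\mathrm{kiss}(P)}$, the sum being over all inchworm paths $P$, i.e. packing paths avoiding the two patterns $\overline U\,\overline D$ and $DU$, where $\mathrm{kiss}(P)$ is the kissing number of $P$. Then $$A'(x,y)=\frac{1-x^4y+x^4y^2-\sqrt{1-2x^4y-2x^4y^2+x^8y^2-2x^8y^3+x^8y^4}}{2x^4y^2}.$$
   Context: Consider the hexagonal packing of the plane by circles of radius $2$ with centers $(2+4i+2j,\,2\sqrt3\,j)$, $i,j\in\mathbb Z$; the origin is the tangency point of two horizontally adjacent circles. The tangency points cut every circle into six arcs. Traversed from left to right these give six types of steps (angles measured on the circle carrying the arc): $U$ from $180^\circ$ to $120^\circ$ (displacement $(1,\sqrt3)$), $F$ from $120^\circ$ to $60^\circ$ (displacement $(2,0)$), $D$ from $60^\circ$ to $0^\circ$ (displacement $(1,-\sqrt3)$), $\overline U$ from $300^\circ$ to $360^\circ$ (displacement $(1,\sqrt3)$), $\overline F$ from $240^\circ$ to $300^\circ$ (displacement $(2,0)$), $\overline D$ from $180^\circ$ to $240^\circ$ (displacement $(1,-\sqrt3)$). A path in the packing starts at the origin, is a concatenation of such arcs of circles of the packing, each starting where the previous one ends, and stays in the quarter plane $x,y\ge 0$. Equivalently, it is a word in $\{U,F,D,\overline U,\overline F,\overline D\}$ whose first step (if any) is $U$, in which $U$ or $\overline F$ can only be followed by $F$ or $\overline U$; $F$ or $\overline D$ only by $\overline F$ or $D$; $\overline U$ or $D$ only by $U$ or $\overline D$; and which never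 goes below ordinate $0$. A packing path is such a path ending on the $x$-axis. The empty path is allowed. The width of a path is the abscissa of its endpoint (so $U,D,\overline U,\overline D$ contribute $1$ and $F,\overline F$ contribute $2$). The kissing number of a packing path is the number of circles of the packing lying below the path (under the path, with center of ordinate $\ge0$, between its starting and ending abscissas) that touch it, touching at a single point (a tangency point) included. Avoiding a pattern means that the two given steps never occur consecutively in the path. The square root is the formal power series with constant term $1$. *)

theory Defs
  imports
    "HOL-Analysis.Analysis"
    "HOL-Computational_Algebra.Computational_Algebra"
    "HOL-Library.Sublist"
begin

text \<open>The plane is identified with the type of complex numbers, the point of abscissa \<open>a\<close> and
  ordinate \<open>b\<close> being \<open>Complex a b\<close>.\<close>

definition centers :: "complex set" where
  "centers = {Complex (2 + 4 * of_int i + 2 * of_int j) (2 * sqrt 3 * of_int j) | i j :: int. True}"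

datatype step = U | F | D | U_bar | F_bar | D_bar

fun start_angle :: "step \<Rightarrow> real" where
  "start_angle U = pi"
| "start_angle F = 2 * pi / 3"
| "start_angle D = pi / 3"
| "start_angle U_bar = 5 * pi / 3"
| "start_angle F_bar = 4 * pi / 3"
| "start_angle D_bar = pi"

fun end_angle :: "step \<Rightarrow> real" where
  "end_angle U = 2 * pi / 3"
| "end_angle F = pi / 3"
| "end_angle D = 0"
| "end_angle U_bar = 2 * pi"
| "end_angle F_bar = 5 * pi / 3"
| "end_angle D_bar = 4 * pi / 3"

text \<open>The circle of radius 2 carrying a step that starts at the point \<open>p\<close> is determined by \<open>p\<close> and
  the start angle.\<close>

definition step_center :: "complex \<Rightarrow> step \<Rightarrow> complex" where
  "step_center p s = p - 2 * cis (start_angle s)"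

definition step_arc :: "complex \<Rightarrow> step \<Rightarrow> complex set" where
  "step_arc p s =
     (\<lambda>t. step_center p s + 2 * cis t) ` closed_segment (start_angle s) (end_angle s)"

definition step_end :: "complex \<Rightarrow> step \<Rightarrow> complex" where
  "step_end p s = step_center p s + 2 * cis (end_angle s)"

fun arcs_in_packing :: "complex \<Rightarrow> step list \<Rightarrow> bool" where
  "arcs_in_packing p [] = True"
| "arcs_in_packing p (s # w) \<longleftrightarrow>
     step_center p s \<in> centers \<and> arcs_in_packing (step_end p s) w"

fun curve_from :: "complex \<Rightarrow> step list \<Rightarrow> complex set" where
  "curve_from p [] = {p}"
| "curve_from p (s # w) = step_arc p s \<union> curve_from (step_end p s) w"

abbreviation curve :: "step list \<Rightarrow> complex set" where
  "curve w \<equiv> curve_from 0 w"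

definition endpoint :: "step list \<Rightarrow> complex" where
  "endpoint w = foldl step_end 0 w"

definition path_in_packing :: "step list \<Rightarrow> bool" where
  "path_in_packing w \<longleftrightarrow>
     arcs_in_packing 0 w \<and> (\<forall>z\<in>curve w. 0 \<le> Re z \<and> 0 \<le> Im z)"

definition packing_path :: "step list \<Rightarrow> bool" where
  "packing_path w \<longleftrightarrow> path_in_packing w \<and> Im (endpoint w) = 0"

definition width :: "step list \<Rightarrow> real" where
  "width w = Re (endpoint w)"

text \<open>Every path is weakly monotone in the abscissa, so that "under" compares points of equal
  abscissa. The comparison is weak: a circle may share points, even whole arcs, with a path above
  it.\<close>

definition lies_below :: "complex \<Rightarrow> step list \<Rightarrow> bool" where
  "lies_below c w \<longleftrightarrow>
     (\<forall>p\<in>sphere c 2. 0 \<le> Re p \<and> Re p \<le> width w) \<and>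
     (\<forall>p\<in>sphere c 2. \<forall>q\<in>curve w. Re p = Re q \<longrightarrow> Im p \<le> Im q)"

definition kiss :: "step list \<Rightarrow> nat" where
  "kiss w =
     card {c \<in> centers. 0 \<le> Im c \<and> lies_below c w \<and> sphere c 2 \<inter> curve w \<noteq> {}}"

definition inchworm :: "step list \<Rightarrow> bool" where
  "inchworm w \<longleftrightarrow> packing_path w \<and> \<not> sublist [U_bar, D_bar] w \<and> \<not> sublist [D, U] w"

text \<open>Bivariate power series in \<open>x\<close> and \<open>y\<close> are power series in \<open>x\<close> whose coefficients are power
  series in \<open>y\<close>; thus \<open>x\<close> is \<open>fps_X\<close> and \<open>y\<close> is \<open>fps_const fps_X\<close>.\<close>

definition inchworm_gf :: "real fps fps" where
  "inchworm_gf =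
     Abs_fps (\<lambda>n. Abs_fps (\<lambda>k. of_nat (card {w. inchworm w \<and> width w = of_nat n \<and> kiss w = k})))"

text \<open>The library's \<open>fps_radical\<close> requires coefficients in a field. Since power series in two
  variables form an integral domain, there is at most one square root with constant term 1.\<close>

definition fps2_sqrt :: "real fps fps \<Rightarrow> real fps fps" where
  "fps2_sqrt R = (THE S. S ^ 2 = R \<and> fps_nth (fps_nth S 0) 0 = 1)"

end

(*
  A nonempty inchworm path visits, at every odd abscissa between its ends, exactly one tangency
  point of odd level (ordinate sqrt 3 times an odd integer); between consecutive ones it makes
  one of the moves F, F_bar, U_bar U, D D_bar. Reading F as a peak, F_bar as a valley, and the
  other two moves as double rises and double falls gives a bijection with Dyck paths, hence with
  binary trees, in which the width is 4 times the number of nodes.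

  A circle is kissed by a path exactly when the path goes through its point at angle 120 or 60
  degrees: from there the path cannot enter the disc any more, and conversely every other point of
  contact either forces one of these two or shows that the circle is not below the path. So the
  kissing number of a tree counts each node once and once more if its left subtree is nonempty,
  which gives A = 1 + x^4 y A + x^4 y^2 (A - 1) A.
*)

theory Submission
  imports Defs
begin

unbundle no vec_syntax

section \<open>Bivariate generating functions\<close>

text \<open>Draw a Dyck path with steps \<open>(2, 2)\<close> and \<open>(2, -2)\<close>, measuring
  abscissas in units of 1 and ordinates in units of \<open>sqrt 3\<close>. The odd-level tangency
  points of an inchworm path are the midpoints of these steps: the point at 120 degrees on a circle
  for an up step, the point at 60 degrees for a down step. A node, being an up step with its
  matching down step, therefore has width 4. Each midpoint contributes the circle just beneath it,
  and two of these circles coincide only at a peak, where \<open>F\<close> joins both midpoints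
  along one circle; hence 1 or 2 kisses per node. The two avoided patterns are exactly the turns at
  even-level vertices.

  The main obstacle is geometric: lying below compares two real curves at every abscissa. The
  condition \<open>over\<close> replaces this by an integer condition on single vertices, which
  spreads from one point of contact along the path in both directions.\<close>

definition gf :: "('a \<Rightarrow> nat) \<Rightarrow> ('a \<Rightarrow> nat) \<Rightarrow> 'a set \<Rightarrow> real fps fps" where
  "gf f g S = Abs_fps (\<lambda>n. Abs_fps (\<lambda>k. of_nat (card {s \<in> S. f s = n \<and> g s = k})))"

lemma gf_nth [simp]: "gf f g S $ n $ k = of_nat (card {s \<in> S. f s = n \<and> g s = k})"
  by (simp add: gf_def)

text \<open>The finite fibers of \<open>f\<close> contain the sets counted by the coefficients. This
  guards against the convention that an infinite set has cardinality 0.\<close>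

lemma gf_Un:
  assumes "S \<inter> T = {}" "\<And>n. finite {s \<in> S. f s = n}" "\<And>n. finite {s \<in> T. f s = n}"
  shows "gf f g (S \<union> T) = gf f g S + gf f g T"
proof (rule fps_ext, rule fps_ext)
  fix n k
  have "{s \<in> S \<union> T. f s = n \<and> g s = k} = {s \<in> S. f s = n \<and> g s = k} \<union> {s \<in> T. f s = n \<and> g s = k}"
    by auto
  also have "card \<dots> = card {s \<in> S. f s = n \<and> g s = k} + card {s \<in> T. f s = n \<and> g s = k}"
    using assms(1) by (intro card_Un_disjoint finite_subset[OF _ assms(2)[of n]] finite_subset[OF _ assms(3)[of n]]) auto
  finally show "gf f g (S \<union> T) $ n $ k = (gf f g S + gf f g T) $ n $ k"
    by simp
qed

lemma gf_image:
  assumes "inj_on h S"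
  shows "gf f g (h ` S) = gf (f \<circ> h) (g \<circ> h) S"
proof (rule fps_ext, rule fps_ext)
  fix n k
  have "{s \<in> h ` S. f s = n \<and> g s = k} = h ` {s \<in> S. f (h s) = n \<and> g (h s) = k}"
    by auto
  moreover have "inj_on h {s \<in> S. f (h s) = n \<and> g (h s) = k}"
    using assms by (rule inj_on_subset) auto
  ultimately show "gf f g (h ` S) $ n $ k = gf (f \<circ> h) (g \<circ> h) S $ n $ k"
    by (simp add: card_image)
qed

lemma gf_shift:
  "gf (\<lambda>s. a + f s) (\<lambda>s. b + g s) S = fps_X ^ a * fps_const fps_X ^ b * gf f g S"
proof (rule fps_ext, rule fps_ext)
  fix n k
  have eq: "{s \<in> S. a + f s = n \<and> b + g s = k} =
      (if n < a \<or> k < b then {} else {s \<in> S. f s = n - a \<and> g s = k - b})"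
    by auto
  show "gf (\<lambda>s. a + f s) (\<lambda>s. b + g s) S $ n $ k = (fps_X ^ a * fps_const fps_X ^ b * gf f g S) $ n $ k"
    by (auto simp: eq mult.assoc fps_X_power_mult_nth fps_const_power)
qed

text \<open>A Cauchy product in both variables: each pair belongs to exactly one splitting of
  \<open>n\<close> and one of \<open>k\<close>.\<close>

lemma gf_Times:
  assumes fin: "\<And>n. finite {s \<in> S. f s = n}" "\<And>n. finite {t \<in> T. f' t = n}"
  shows "gf (\<lambda>(s, t). f s + f' t) (\<lambda>(s, t). g s + g' t) (S \<times> T) = gf f g S * gf f' g' T"
proof (rule fps_ext, rule fps_ext)
  fix n k
  define A where "A i j = {s \<in> S. f s = i \<and> g s = j}" for i j
  define B where "B i j = {t \<in> T. f' t = i \<and> g' t = j}" for i j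
  have finA: "finite (A i j)" for i j
    unfolding A_def by (rule finite_subset[OF _ fin(1)[of i]]) auto
  have finB: "finite (B i j)" for i j
    unfolding B_def by (rule finite_subset[OF _ fin(2)[of i]]) auto
  have "{p \<in> S \<times> T. (\<lambda>(s, t). f s + f' t) p = n \<and> (\<lambda>(s, t). g s + g' t) p = k} =
      (\<Union>(i, j)\<in>{0..n} \<times> {0..k}. A i j \<times> B (n - i) (k - j))"
    by (auto simp: A_def B_def)
  also have "card \<dots> = (\<Sum>p\<in>{0..n} \<times> {0..k}. card (case p of (i, j) \<Rightarrow> A i j \<times> B (n - i) (k - j)))"
  proof (intro card_UN_disjoint ballI impI)
    fix p q :: "nat \<times> nat"
    assume "p \<noteq> q"
    then show "(case p of (i, j) \<Rightarrow> A i j \<times> B (n - i) (k - j)) \<inter>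
        (case q of (i, j) \<Rightarrow> A i j \<times> B (n - i) (k - j)) = {}"
      by (auto simp: A_def split: prod.splits)
  qed (auto simp: finA finB)
  also have "\<dots> = (\<Sum>(i, j)\<in>{0..n} \<times> {0..k}. card (A i j) * card (B (n - i) (k - j)))"
    by (intro sum.cong) (auto simp: card_cartesian_product)
  also have "\<dots> = (\<Sum>i=0..n. \<Sum>j=0..k. card (A i j) * card (B (n - i) (k - j)))"
    by (simp add: sum.cartesian_product)
  finally show "gf (\<lambda>(s, t). f s + f' t) (\<lambda>(s, t). g s + g' t) (S \<times> T) $ n $ k =
      (gf f g S * gf f' g' T) $ n $ k"
    by (simp add: fps_mult_nth fps_sum_nth A_def B_def)
qed

section \<open>Binary trees\<close>

datatype dtree = E | N dtree dtree

fun weight :: "dtree \<Rightarrow> nat" where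
  "weight E = 0"
| "weight (N P Q) = 4 + (weight P + weight Q)"

fun kisses :: "dtree \<Rightarrow> nat" where
  "kisses E = 0"
| "kisses (N P Q) = (if P = E then 1 else 2) + (kisses P + kisses Q)"

text \<open>The root weighs 4, so both subtrees are strictly lighter and come from a finite set by
  induction.\<close>

lemma finite_weight_le: "finite {t. weight t \<le> n}"
proof (induction n rule: less_induct)
  case (less n)
  let ?S = "{t. weight t < n}"
  have "finite ?S"
  proof (cases n)
    case (Suc m)
    then have "?S = {t. weight t \<le> m}"
      by auto
    then show ?thesis
      using less[of m] Suc by simp
  qed simp
  moreover have "{t. weight t \<le> n} \<subseteq> insert E ((\<lambda>(P, Q). N P Q) ` (?S \<times> ?S))"
  proof
    fix t
    assume "t \<in> {t. weight t \<le> n}"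
    then show "t \<in> insert E ((\<lambda>(P, Q). N P Q) ` (?S \<times> ?S))"
      by (cases t) auto
  qed
  ultimately show ?case
    by (auto intro: finite_subset)
qed

lemma finite_weight_eq: "finite {t \<in> S. weight t = n}"
  by (rule finite_subset[OF _ finite_weight_le[of n]]) auto

abbreviation tree_gf :: "dtree set \<Rightarrow> real fps fps" where
  "tree_gf \<equiv> gf weight kisses"

lemma tree_gf_E: "tree_gf {E} = 1"
proof (rule fps_ext, rule fps_ext)
  fix n k
  have "{s \<in> {E}. weight s = n \<and> kisses s = k} = (if n = 0 \<and> k = 0 then {E} else {})"
    by auto
  then show "tree_gf {E} $ n $ k = 1 $ n $ k"
    by simp
qed

text \<open>The kisses added by the root depend only on whether the left subtree is empty, so they
  are a constant \<open>c\<close> on each of the two classes of trees that occur.\<close>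

lemma tree_gf_N:
  assumes "\<And>P Q. P \<in> S \<Longrightarrow> kisses (N P Q) = c + (kisses P + kisses Q)"
  shows "tree_gf ((\<lambda>(P, Q). N P Q) ` (S \<times> T)) =
    fps_X ^ 4 * fps_const fps_X ^ c * (tree_gf S * tree_gf T)"
proof -
  have inj: "inj_on (\<lambda>(P, Q). N P Q) (S \<times> T)"
    by (auto simp: inj_on_def)
  \<comment> \<open>The statistics are known to agree only on \<open>S \<times> T\<close>, so the
    counted sets are rewritten instead of the functions.\<close>
  have set_eq: "{p \<in> S \<times> T. (weight \<circ> (\<lambda>(P, Q). N P Q)) p = n \<and> (kisses \<circ> (\<lambda>(P, Q). N P Q)) p = k} =
      {p \<in> S \<times> T. 4 + (\<lambda>(P, Q). weight P + weight Q) p = n \<and>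
        c + (\<lambda>(P, Q). kisses P + kisses Q) p = k}" for n k
    using assms by (auto simp del: kisses.simps)
  have "tree_gf ((\<lambda>(P, Q). N P Q) ` (S \<times> T)) =
      gf (\<lambda>p. 4 + (\<lambda>(P, Q). weight P + weight Q) p) (\<lambda>p. c + (\<lambda>(P, Q). kisses P + kisses Q) p) (S \<times> T)"
    unfolding gf_image[OF inj] unfolding gf_def set_eq ..
  then show ?thesis
    by (simp only: gf_shift gf_Times[OF finite_weight_eq finite_weight_eq])
qed

lemma tree_gf_UNIV:
  fixes x y A :: "real fps fps"
  defines "x \<equiv> fps_X" and "y \<equiv> fps_const fps_X" and "A \<equiv> tree_gf UNIV"
  shows "A = 1 + x ^ 4 * y * A + x ^ 4 * y ^ 2 * (A - 1) * A"
proof -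
  define T where "T = UNIV - {E}"
  define L where "L = (\<lambda>(P, Q). N P Q) ` ({E} \<times> UNIV)"
  define R where "R = (\<lambda>(P, Q). N P Q) ` (T \<times> UNIV)"
  have "tree_gf ({E} \<union> T) = tree_gf {E} + tree_gf T"
    by (rule gf_Un[OF _ finite_weight_eq finite_weight_eq]) (auto simp: T_def)
  moreover have "{E} \<union> T = UNIV"
    by (auto simp: T_def)
  ultimately have A: "A = 1 + tree_gf T"
    by (simp only: A_def tree_gf_E)
  have "t \<in> T \<longleftrightarrow> t \<in> L \<union> R" for t
    by (cases t) (auto simp: T_def L_def R_def)
  then have "T = L \<union> R"
    by blast
  moreover have "tree_gf (L \<union> R) = tree_gf L + tree_gf R"
    by (rule gf_Un[OF _ finite_weight_eq finite_weight_eq]) (auto simp: L_def R_def T_def)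
  moreover have "tree_gf L = x ^ 4 * y ^ 1 * (tree_gf {E} * A)"
    unfolding x_def y_def A_def L_def by (rule tree_gf_N) simp
  moreover have "tree_gf R = x ^ 4 * y ^ 2 * (tree_gf T * A)"
    unfolding x_def y_def A_def R_def by (rule tree_gf_N) (simp add: T_def)
  ultimately have "tree_gf T = x ^ 4 * y * A + x ^ 4 * y ^ 2 * (tree_gf T * A)"
    by (simp only: tree_gf_E power_one_right mult_1_left)
  moreover have "tree_gf T = A - 1"
    using A by algebra
  ultimately have "A - 1 = x ^ 4 * y * A + x ^ 4 * y ^ 2 * ((A - 1) * A)"
    by (simp only:)
  then show ?thesis
    by algebra
qed

section \<open>Solving the quadratic equation\<close>

lemma fps2_sqrt_eqI:
  assumes "S ^ 2 = R" "S $ 0 $ 0 = 1"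
  shows "fps2_sqrt R = S"
  unfolding fps2_sqrt_def
proof (rule the_equality)
  show "S ^ 2 = R \<and> S $ 0 $ 0 = 1"
    using assms by simp
next
  fix S' :: "real fps fps"
  assume S': "S' ^ 2 = R \<and> S' $ 0 $ 0 = 1"
  \<comment> \<open>In an integral domain the only other root is \<open>- S\<close>, whose constant
    term is -1.\<close>
  then have "S' = S \<or> S' = - S"
    using assms(1) by (metis power2_eq_iff)
  then show "S' = S"
    using S' assms(2) by auto
qed

text \<open>The denominator has constant term 0 and is not invertible as a power series, so the
  quotient is taken in the fraction field.\<close>

lemma closed_form_of_quadratic:
  fixes A :: "real fps fps"
  assumes "x = fps_X" "y = fps_const fps_X"
    and A: "A = 1 + x ^ 4 * y * A + x ^ 4 * y ^ 2 * (A - 1) * A"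
  shows "to_fract A =
      to_fract (1 - x^4 * y + x^4 * y^2
        - fps2_sqrt (1 - 2 * x^4 * y - 2 * x^4 * y^2 + x^8 * y^2 - 2 * x^8 * y^3 + x^8 * y^4))
      / to_fract (2 * x^4 * y^2)"
proof -
  \<comment> \<open>The equation reads \<open>a * A^2 + b * A + 1 = 0\<close> with
    \<open>a = x^4 * y^2\<close> and \<open>b = x^4 * y - x^4 * y^2 - 1\<close>. Then
    \<open>S = - (2 * a * A + b)\<close> squares to the discriminant \<open>b^2 - 4 * a\<close>, and
    this sign gives the constant term 1.\<close>
  define S where "S = 1 - x ^ 4 * y + x ^ 4 * y ^ 2 - 2 * x ^ 4 * y ^ 2 * A"
  have x8: "x ^ 8 = x ^ 4 * x ^ 4"
    by (simp flip: power_add)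
  have "S ^ 2 = 1 - 2 * x^4 * y - 2 * x^4 * y^2 + x^8 * y^2 - 2 * x^8 * y^3 + x^8 * y^4"
    using A unfolding S_def x8 by algebra
  moreover have "S $ 0 $ 0 = 1"
    by (simp add: S_def assms(1))
  ultimately have "fps2_sqrt (1 - 2 * x^4 * y - 2 * x^4 * y^2 + x^8 * y^2 - 2 * x^8 * y^3 + x^8 * y^4) = S"
    by (rule fps2_sqrt_eqI)
  moreover have "1 - x ^ 4 * y + x ^ 4 * y ^ 2 - S = A * (2 * x ^ 4 * y ^ 2)"
    by (simp add: S_def algebra_simps)
  moreover have "2 * x ^ 4 * y ^ 2 \<noteq> 0"
    by (simp add: assms(1,2))
  ultimately show ?thesis
    by simp
qed

section \<open>Paths on the lattice of tangency points\<close>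

text \<open>All centers and tangency points lie on this grid, so incidences become statements about
  integers.\<close>

definition pt :: "int \<times> int \<Rightarrow> complex" where
  "pt p = Complex (of_int (fst p)) (sqrt 3 * of_int (snd p))"

lemma Re_pt [simp]: "Re (pt p) = of_int (fst p)"
  and Im_pt [simp]: "Im (pt p) = sqrt 3 * of_int (snd p)"
  by (simp_all add: pt_def)

lemma inj_pt: "inj pt"
  by (auto simp: inj_def pt_def prod_eq_iff)

definition is_center :: "int \<times> int \<Rightarrow> bool" where
  "is_center c \<longleftrightarrow> even (snd c) \<and> (fst c - snd c) mod 4 = 2"

lemma pt_in_centers: "pt c \<in> centers \<longleftrightarrow> is_center c"
proof
  assume "pt c \<in> centers"
  then obtain i j where "pt c = Complex (2 + 4 * of_int i + 2 * of_int j) (2 * sqrt 3 * of_int j)"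
    unfolding centers_def by blast
  then have "real_of_int (fst c) = of_int (2 + 4 * i + 2 * j)" "real_of_int (snd c) = of_int (2 * j)"
    by (simp_all add: pt_def)
  then have "fst c = 2 + 4 * i + 2 * j" "snd c = 2 * j"
    by (simp_all only: of_int_eq_iff)
  then show "is_center c"
    unfolding is_center_def by presburger
next
  assume "is_center c"
  then obtain i j where "snd c = 2 * j" "fst c = 2 + 4 * i + 2 * j"
    unfolding is_center_def by (metis add.commute diff_eq_eq dvdE mult_div_mod_eq)
  then show "pt c \<in> centers"
    unfolding centers_def by (intro CollectI exI[of _ i] exI[of _ j]) (simp add: pt_def)
qed

lemma centers_eq: "centers = pt ` {c. is_center c}"
proof -
  have "z \<in> range pt" if "z \<in> centers" for z
  proof -
    from that obtain i j where "z = Complex (2 + 4 * of_int i + 2 * of_int j) (2 * sqrt 3 * of_int j)"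
      unfolding centers_def by blast
    then have "z = pt (2 + 4 * i + 2 * j, 2 * j)"
      by (simp add: pt_def)
    then show ?thesis
      by blast
  qed
  then show ?thesis
    using pt_in_centers by blast
qed

fun ctr :: "int \<times> int \<Rightarrow> step \<Rightarrow> int \<times> int" where
  "ctr (a, b) U = (a + 2, b)"
| "ctr (a, b) F = (a + 1, b - 1)"
| "ctr (a, b) D = (a - 1, b - 1)"
| "ctr (a, b) U_bar = (a - 1, b + 1)"
| "ctr (a, b) F_bar = (a + 1, b + 1)"
| "ctr (a, b) D_bar = (a + 2, b)"

fun move :: "int \<times> int \<Rightarrow> step \<Rightarrow> int \<times> int" where
  "move (a, b) U = (a + 1, b + 1)"
| "move (a, b) F = (a + 2, b)"
| "move (a, b) D = (a + 1, b - 1)"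
| "move (a, b) U_bar = (a + 1, b + 1)"
| "move (a, b) F_bar = (a + 2, b)"
| "move (a, b) D_bar = (a + 1, b - 1)"

lemma cos_240: "cos (4 * pi / 3) = - 1 / 2" and sin_240: "sin (4 * pi / 3) = - sqrt 3 / 2"
  using cos_periodic_pi2[of "pi / 3"] sin_periodic_pi2[of "pi / 3"]
  by (simp_all add: cos_60 sin_60 field_simps)

lemma cos_300: "cos (5 * pi / 3) = 1 / 2" and sin_300: "sin (5 * pi / 3) = - sqrt 3 / 2"
  using cos_2pi_minus[of "pi / 3"] sin_2pi_minus[of "pi / 3"]
  by (simp_all add: cos_60 sin_60 field_simps)

lemmas angle_simps = cos_60 sin_60 cos_120 sin_120 cos_240 sin_240 cos_300 sin_300
  cos_120' sin_120' cos_240[unfolded mult.commute[of 4 pi]] sin_240[unfolded mult.commute[of 4 pi]]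
  cos_300[unfolded mult.commute[of 5 pi]] sin_300[unfolded mult.commute[of 5 pi]]

lemma step_center_pt: "step_center (pt p) s = pt (ctr p s)"
  by (cases p; cases s) (simp_all add: step_center_def complex_eq_iff angle_simps algebra_simps)

lemma step_end_pt: "step_end (pt p) s = pt (move p s)"
  unfolding step_end_def step_center_pt
  by (cases p; cases s) (simp_all add: complex_eq_iff angle_simps algebra_simps)

definition upper :: "step \<Rightarrow> bool" where
  "upper s \<longleftrightarrow> s \<in> {U, F, D}"

text \<open>Upper arcs run through angles in \<open>[0, pi]\<close> backwards, lower arcs through
  \<open>[pi, 2 * pi]\<close> forwards. Either way the cosine grows along the arc and the sine keeps
  its sign.\<close>

lemma arc_facts:
  assumes "z \<in> step_arc (pt p) s"
  shows "z \<in> sphere (pt (ctr p s)) 2"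
    and "of_int (fst p) \<le> Re z" "Re z \<le> of_int (fst (move p s))"
    and "upper s \<Longrightarrow> Im (pt (ctr p s)) \<le> Im z"
    and "\<not> upper s \<Longrightarrow> Im z \<le> Im (pt (ctr p s))"
proof -
  from assms obtain t where t: "t \<in> closed_segment (start_angle s) (end_angle s)"
    and z: "z = pt (ctr p s) + 2 * cis t"
    unfolding step_arc_def step_center_pt by blast
  show "z \<in> sphere (pt (ctr p s)) 2"
    by (simp add: z dist_norm norm_mult)
  have p: "of_int (fst p) = Re (pt (ctr p s)) + 2 * cos (start_angle s)"
    using arg_cong[OF step_center_pt[of p s], of Re] by (simp add: step_center_def)
  have e: "of_int (fst (move p s)) = Re (pt (ctr p s)) + 2 * cos (end_angle s)"
    using arg_cong[OF step_end_pt[of p s], of Re] by (simp add: step_end_def step_center_pt)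
  have seg: "closed_segment (start_angle s) (end_angle s) =
      (if upper s then {end_angle s..start_angle s} else {start_angle s..end_angle s})"
    using pi_gt_zero by (cases s) (simp_all add: closed_segment_eq_real_ivl upper_def field_simps not_le)
  have range: "0 \<le> end_angle s" "end_angle s \<le> 2 * pi"
    "if upper s then start_angle s \<le> pi else pi \<le> start_angle s"
    using pi_gt_zero by (cases s; simp add: upper_def)+
  have "cos (start_angle s) \<le> cos t \<and> cos t \<le> cos (end_angle s) \<and>
    (if upper s then 0 \<le> sin t else sin t \<le> 0)"
  proof (cases "upper s")
    case True
    then have "0 \<le> end_angle s" "end_angle s \<le> t" "t \<le> start_angle s" "start_angle s \<le> pi"
      using t seg range by auto
    then show ?thesis
      using True by (auto intro!: cos_monotone_0_pi_le sin_ge_zero)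
  next
    case False
    then have *: "pi \<le> start_angle s" "start_angle s \<le> t" "t \<le> end_angle s" "end_angle s \<le> 2 * pi"
      using t seg range by auto
    \<comment> \<open>The reflection \<open>t\<close> to \<open>2 * pi - t\<close> moves the lower
      half into \<open>[0, pi]\<close>, where the cosine decreases.\<close>
    have "cos (2 * pi - start_angle s) \<le> cos (2 * pi - t)"
      "cos (2 * pi - t) \<le> cos (2 * pi - end_angle s)" "0 \<le> sin (2 * pi - t)"
      using * by (intro cos_monotone_0_pi_le sin_ge_zero; linarith)+
    then show ?thesis
      using False by simp
  qed
  then show "of_int (fst p) \<le> Re z" "Re z \<le> of_int (fst (move p s))"
    "upper s \<Longrightarrow> Im (pt (ctr p s)) \<le> Im z" "\<not> upper s \<Longrightarrow> Im z \<le> Im (pt (ctr p s))"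
    unfolding p e z by (simp_all split: if_splits)
qed

lemma pt_in_arc: "pt p \<in> step_arc (pt p) s" "pt (move p s) \<in> step_arc (pt p) s"
proof -
  show "pt p \<in> step_arc (pt p) s"
    unfolding step_arc_def by (rule image_eqI[of _ _ "start_angle s"]) (simp_all add: step_center_def)
  show "pt (move p s) \<in> step_arc (pt p) s"
    unfolding step_arc_def
    by (rule image_eqI[of _ _ "end_angle s"]) (simp_all flip: step_end_pt add: step_end_def)
qed

fun centered :: "int \<times> int \<Rightarrow> step list \<Rightarrow> bool" where
  "centered p [] = True"
| "centered p (s # w) \<longleftrightarrow> is_center (ctr p s) \<and> centered (move p s) w"

fun verts :: "int \<times> int \<Rightarrow> step list \<Rightarrow> (int \<times> int) set" where
  "verts p [] = {p}"
| "verts p (s # w) = insert p (verts (move p s) w)"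

abbreviation pos :: "int \<times> int \<Rightarrow> step list \<Rightarrow> int \<times> int" where
  "pos \<equiv> foldl move"

lemma arcs_in_packing_pt: "arcs_in_packing (pt p) w \<longleftrightarrow> centered p w"
  by (induction w arbitrary: p) (simp_all add: step_center_pt step_end_pt pt_in_centers)

lemma foldl_step_end_pt: "foldl step_end (pt p) w = pt (pos p w)"
  by (induction w arbitrary: p) (simp_all add: step_end_pt)

lemma centered_append: "centered p (u @ v) \<longleftrightarrow> centered p u \<and> centered (pos p u) v"
  by (induction u arbitrary: p) auto

lemma start_in_verts: "p \<in> verts p w"
  by (cases w) auto

lemma pos_in_verts: "pos p w \<in> verts p w"
  by (induction w arbitrary: p) auto

lemma verts_append: "verts p (u @ v) = verts p u \<union> verts (pos p u) v"
  by (induction u arbitrary: p) (auto simp: start_in_verts)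

lemma verts_split:
  assumes "v \<in> verts p w"
  obtains u r where "w = u @ r" "v = pos p u"
  using assms
proof (induction w arbitrary: p thesis)
  case Nil
  then show ?case
    by (metis append_Nil foldl_Nil singletonD verts.simps(1))
next
  case (Cons s w)
  show ?case
  proof (cases "v = p")
    case True
    then show ?thesis
      using Cons.prems(1)[of "[]"] by simp
  next
    case False
    then obtain u r where "w = u @ r" "v = pos (move p s) u"
      using Cons.IH[of "move p s"] Cons.prems(2) by auto
    then show ?thesis
      using Cons.prems(1)[of "s # u" r] by simp
  qed
qed

lemma fst_move: "fst p < fst (move p s)"
  by (cases p; cases s) auto

lemma verts_fst_ge: "v \<in> verts p w \<Longrightarrow> fst p \<le> fst v"
proof (induction w arbitrary: p)
  case (Cons s w)
  show ?case
    using fst_move[of p s] Cons.IH[of "move p s"] Cons.prems by force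
qed simp

lemma verts_fst_le: "v \<in> verts p w \<Longrightarrow> fst v \<le> fst (pos p w)"
  by (metis pos_in_verts verts_fst_ge verts_split foldl_append)

lemma verts_in_curve: "v \<in> verts p w \<Longrightarrow> pt v \<in> curve_from (pt p) w"
proof (induction w arbitrary: p)
  case (Cons s w)
  show ?case
    using pt_in_arc[of p s] Cons.IH[of "move p s"] Cons.prems by (auto simp: step_end_pt)
qed simp

lemma curve_Re_ge: "q \<in> curve_from (pt p) w \<Longrightarrow> of_int (fst p) \<le> Re q"
proof (induction w arbitrary: p)
  case (Cons s w)
  then consider "q \<in> step_arc (pt p) s" | "q \<in> curve_from (pt (move p s)) w"
    by (auto simp: step_end_pt)
  then show ?case
  proof cases
    case 2
    then show ?thesis
      using Cons.IH[OF 2] fst_move[of p s] by linarith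
  qed (rule arc_facts)
qed simp

text \<open>Centers have even level. With both ends of the arc at level 0 or more, parity puts the
  center of an upper arc at level at least 0, and that of a lower arc at level at least 2, hence at
  height at least \<open>2 * sqrt 3\<close>, which exceeds the radius.\<close>

lemma arc_Im_nonneg:
  assumes "is_center (ctr p s)" "0 \<le> snd p" "0 \<le> snd (move p s)" "z \<in> step_arc (pt p) s"
  shows "0 \<le> Im z"
proof (cases "upper s")
  case True
  then have "0 \<le> snd (ctr p s)"
    using assms(1-3) unfolding is_center_def upper_def
    by (cases p; cases s) (auto, presburger+)
  then show ?thesis
    using arc_facts(4)[OF assms(4) True] by (simp add: order_trans[rotated])
next
  case False
  then have "2 \<le> snd (ctr p s)"
    using assms(1-3) unfolding is_center_def upper_def
    by (cases p; cases s) (auto, presburger+)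
  then have "sqrt 3 * 2 \<le> sqrt 3 * of_int (snd (ctr p s))"
    by (intro mult_left_mono) auto
  moreover have "1 \<le> sqrt 3"
    by simp
  moreover have "\<bar>Im (z - pt (ctr p s))\<bar> \<le> 2"
    using abs_Im_le_cmod[of "z - pt (ctr p s)"] arc_facts(1)[OF assms(4)]
    by (simp add: dist_norm norm_minus_commute)
  ultimately show ?thesis
    unfolding minus_complex.sel Im_pt by linarith
qed

lemma curve_Im_nonneg:
  assumes "centered p w" "\<forall>v\<in>verts p w. 0 \<le> snd v" "z \<in> curve_from (pt p) w"
  shows "0 \<le> Im z"
  using assms
proof (induction w arbitrary: p)
  case (Cons s w)
  show ?case
  proof (cases "z \<in> step_arc (pt p) s")
    case True
    then show ?thesis
      using Cons.prems start_in_verts[of "move p s" w] by (intro arc_Im_nonneg[of p s]) auto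
  next
    case False
    then show ?thesis
      using Cons.prems by (intro Cons.IH[of "move p s"]) (auto simp: step_end_pt)
  qed
qed simp

lemma pt_0: "pt (0, 0) = 0"
  by (simp add: complex_eq_iff)

lemma packing_path_iff:
  "packing_path w \<longleftrightarrow>
    centered (0, 0) w \<and> (\<forall>v\<in>verts (0, 0) w. 0 \<le> snd v) \<and> snd (pos (0, 0) w) = 0"
proof -
  have "0 \<le> Re z" if "z \<in> curve w" for z
    using curve_Re_ge[of z "(0, 0)" w] that by (simp add: pt_0)
  moreover have "0 \<le> snd v" if "v \<in> verts (0, 0) w" "\<forall>z\<in>curve w. 0 \<le> Im z" for v
    using verts_in_curve[OF that(1)] that(2) by (force simp: pt_0 zero_le_mult_iff)
  moreover have "0 \<le> Im z"
    if "centered (0, 0) w" "\<forall>v\<in>verts (0, 0) w. 0 \<le> snd v" "z \<in> curve w" for z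
    using curve_Im_nonneg[of "(0, 0)" w z] that by (simp add: pt_0)
  ultimately show ?thesis
    using arcs_in_packing_pt[of "(0, 0)" w] foldl_step_end_pt[of "(0, 0)" w]
    unfolding packing_path_def path_in_packing_def endpoint_def pt_0 by auto
qed

lemma width_eq: "width w = of_int (fst (pos (0, 0) w))"
  using foldl_step_end_pt[of "(0, 0)" w] by (simp add: width_def endpoint_def pt_0)

section \<open>Kissed circles\<close>

text \<open>The form \<open>n^2 + n * m + m^2\<close> is the norm of the Eisenstein lattice. Up to
  the factor 16 it is the squared distance of two centers that differ by
  \<open>(4 * n + 2 * m, 2 * m)\<close> on the grid.\<close>

lemma hexagonal_norm:
  fixes m n :: int
  shows "(4 * n + 2 * m) ^ 2 + 3 * (2 * m) ^ 2 = 16 * (n ^ 2 + n * m + m ^ 2)"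
    and "n ^ 2 + n * m + m ^ 2 \<le> 1 \<Longrightarrow> \<bar>m\<bar> \<le> 1 \<and> \<bar>n\<bar> \<le> 1"
    and "n ^ 2 + n * m + m ^ 2 \<le> 0 \<Longrightarrow> m = 0 \<and> n = 0"
proof -
  have *: "4 * (n ^ 2 + n * m + m ^ 2) = (2 * n + m) ^ 2 + 3 * m ^ 2"
    "4 * (n ^ 2 + n * m + m ^ 2) = (2 * m + n) ^ 2 + 3 * n ^ 2"
    by algebra+
  have linear: "3 * t \<le> 4 * k" if "q \<le> k" "4 * q = r + 3 * t" "0 \<le> r" for q r t k :: int
    using that by linarith
  have abs_le: "\<bar>k\<bar> \<le> 1" if "3 * k ^ 2 \<le> 4" for k :: int
  proof (rule ccontr)
    assume "\<not> \<bar>k\<bar> \<le> 1"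
    then have "2 ^ 2 \<le> \<bar>k\<bar> ^ 2"
      by (intro power_mono) auto
    then show False
      using that by simp
  qed
  show "(4 * n + 2 * m) ^ 2 + 3 * (2 * m) ^ 2 = 16 * (n ^ 2 + n * m + m ^ 2)"
    by algebra
  show "\<bar>m\<bar> \<le> 1 \<and> \<bar>n\<bar> \<le> 1" if "n ^ 2 + n * m + m ^ 2 \<le> 1"
  proof -
    have "3 * m ^ 2 \<le> 4" "3 * n ^ 2 \<le> 4"
      using linear[OF that *(1) zero_le_power2] linear[OF that *(2) zero_le_power2] by simp_all
    then show ?thesis
      using abs_le by blast
  qed
  show "m = 0 \<and> n = 0" if "n ^ 2 + n * m + m ^ 2 \<le> 0"
  proof -
    have "m ^ 2 \<le> 0" "n ^ 2 \<le> 0"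
      using linear[OF that *(1) zero_le_power2] linear[OF that *(2) zero_le_power2] by simp_all
    then show ?thesis
      by simp
  qed
qed

lemma dist_pt: "dist (pt p) (pt q) ^ 2 = of_int ((fst p - fst q) ^ 2 + 3 * (snd p - snd q) ^ 2)"
proof -
  have "dist (pt p) (pt q) ^ 2 =
      (of_int (fst p) - of_int (fst q)) ^ 2 + (sqrt 3 * (of_int (snd p) - of_int (snd q))) ^ 2"
    by (simp add: dist_norm cmod_power2 right_diff_distrib)
  then show ?thesis
    by (simp add: power_mult_distrib)
qed

lemma center_differences:
  assumes "is_center c" "is_center c'"
  obtains m n where "fst c' - fst c = 4 * n + 2 * m" "snd c' - snd c = 2 * m"
proof -
  obtain m where m: "snd c' - snd c = 2 * m"
    using assms unfolding is_center_def by (metis dvdE dvd_diff)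
  have "4 dvd (fst c' - snd c') - (fst c - snd c)"
    using assms unfolding is_center_def by (metis mod_eq_dvd_iff)
  then obtain n where "(fst c' - snd c') - (fst c - snd c) = 4 * n"
    by (elim dvdE)
  then show thesis
    using m by (intro that[of n m]) auto
qed

lemma center_dist_ge:
  assumes "is_center c" "is_center c'" "c \<noteq> c'"
  shows "4 \<le> dist (pt c) (pt c')"
proof -
  obtain m n where mn: "fst c' - fst c = 4 * n + 2 * m" "snd c' - snd c = 2 * m"
    using assms center_differences by blast
  have "\<not> (m = 0 \<and> n = 0)"
    using mn assms(3) by (auto simp: prod_eq_iff)
  then have "1 \<le> n ^ 2 + n * m + m ^ 2"
    using hexagonal_norm(3)[of n m] by linarith
  then have "16 \<le> (fst c' - fst c) ^ 2 + 3 * (snd c' - snd c) ^ 2"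
    unfolding mn hexagonal_norm(1) by simp
  then have "real_of_int 16 \<le> dist (pt c') (pt c) ^ 2"
    unfolding dist_pt by (simp only: of_int_le_iff)
  then have "4 ^ 2 \<le> dist (pt c) (pt c') ^ 2"
    by (simp add: dist_commute)
  then show ?thesis
    by (rule power2_le_imp_le) simp
qed

text \<open>The perpendicular bisector of the segment joining the centers separates the two circles.\<close>

lemma sphere_le_higher_sphere:
  assumes "z \<in> sphere c r" "q \<in> sphere c' r" "2 * r \<le> dist c c'" "Im c < Im c'" "Re z = Re q"
  shows "Im z \<le> Im q"
proof -
  define d where "d = c' - c"
  have "(z - c) \<bullet> d \<le> r * norm d" "(c' - q) \<bullet> d \<le> r * norm d"
    using norm_cauchy_schwarz[of "z - c" d] norm_cauchy_schwarz[of "c' - q" d] assms(1,2)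
    by (auto simp: dist_norm norm_minus_commute)
  moreover have "2 * r * norm d \<le> d \<bullet> d"
    using assms(3) by (simp add: d_def dist_norm norm_minus_commute dot_square_norm
      power2_eq_square mult_right_mono)
  moreover have "(q - z) \<bullet> d = d \<bullet> d - (z - c) \<bullet> d - (c' - q) \<bullet> d"
    by (simp add: d_def algebra_simps)
  ultimately have "0 \<le> (q - z) \<bullet> d"
    by linarith
  also have "(q - z) \<bullet> d = (Im q - Im z) * (Im c' - Im c)"
    using assms(5) by (simp add: inner_complex_def d_def)
  finally show ?thesis
    using assms(4) by (simp add: zero_le_mult_iff)
qed

lemma sphere_Re_Im:
  assumes "z \<in> sphere c r"
  shows "(Re z - Re c) ^ 2 + (Im z - Im c) ^ 2 = r ^ 2"
  using assms by (auto simp: dist_norm cmod_power2 power2_commute)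

text \<open>Centers at the same height and at least 4 apart leave no common abscissa except that of
  a horizontal tangency, where both points are extreme.\<close>

lemma sphere_level_sphere:
  assumes "z \<in> sphere c 2" "q \<in> sphere c' 2" "4 \<le> dist c c'" "Im c = Im c'" "Re z = Re q"
  shows "Im z = Im q"
proof -
  have "\<bar>Re z - Re c\<bar> \<le> 2" "\<bar>Re q - Re c'\<bar> \<le> 2"
    using abs_Re_le_cmod[of "z - c"] abs_Re_le_cmod[of "q - c'"] assms(1,2)
    by (auto simp: dist_norm norm_minus_commute)
  moreover have "4 \<le> \<bar>Re c - Re c'\<bar>"
    using assms(3,4) by (simp add: dist_norm cmod_def)
  ultimately have "\<bar>Re z - Re c\<bar> = 2" "\<bar>Re q - Re c'\<bar> = 2"
    using assms(5) by linarith+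
  then have "(Re z - Re c) ^ 2 = 2 ^ 2" "(Re q - Re c') ^ 2 = 2 ^ 2"
    by (metis power2_abs)+
  then have "Im z = Im c" "Im q = Im c'"
    using sphere_Re_Im[OF assms(1)] sphere_Re_Im[OF assms(2)] by simp_all
  then show ?thesis
    using assms(4) by simp
qed

lemma sphere_le_upper_half:
  assumes "z \<in> sphere c r" "q \<in> sphere c r" "Im c \<le> Im q" "Re z = Re q"
  shows "Im z \<le> Im q"
proof -
  have "(Im z - Im c) ^ 2 = (Im q - Im c) ^ 2"
    using sphere_Re_Im[OF assms(1)] sphere_Re_Im[OF assms(2)] assms(4) by simp
  then have "\<bar>Im z - Im c\<bar> = \<bar>Im q - Im c\<bar>"
    by (metis power2_abs abs_ge_zero power2_eq_imp_eq)
  then show ?thesis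
    using assms(3) by linarith
qed

text \<open>A tangency point satisfying \<open>over c\<close> is not below the upper half of the circle with center \<open>c\<close>.
  The top of that circle has ordinate 2 above the center, which lies between the levels 1 and 2
  (of height \<open>sqrt 3\<close> each), hence the 2 in the last clause.\<close>

definition over :: "int \<times> int \<Rightarrow> int \<times> int \<Rightarrow> bool" where
  "over c p \<longleftrightarrow>
    (\<bar>fst p - fst c\<bar> = 2 \<longrightarrow> snd c \<le> snd p) \<and>
    (\<bar>fst p - fst c\<bar> = 1 \<longrightarrow> snd c + 1 \<le> snd p) \<and>
    (fst p = fst c \<longrightarrow> snd c + 2 \<le> snd p)"

lemma over_pair:
  "over (a, b) (a + d, b + e) \<longleftrightarrow>
    (d = 2 \<or> d = -2 \<longrightarrow> 0 \<le> e) \<and> (d = 1 \<or> d = -1 \<longrightarrow> 1 \<le> e) \<and> (d = 0 \<longrightarrow> 2 \<le> e)"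
  by (auto simp: over_def)

text \<open>Coordinates relative to \<open>c\<close> leave a few small integers, so that the lemmas
  on \<open>over\<close> reduce to finite case checks.\<close>

lemma center_step_cases:
  assumes "is_center c" "is_center (ctr p s)"
  obtains a b d e n m where "c = (a, b)" "p = (a + d, b + e)" "ctr (d, e) s = (4 * n + 2 * m, 2 * m)"
proof -
  obtain m n where "fst (ctr p s) - fst c = 4 * n + 2 * m" "snd (ctr p s) - snd c = 2 * m"
    using center_differences[OF assms] by blast
  then show thesis
    by (intro that[of "fst c" "snd c" "fst p - fst c" "snd p - snd c" n m])
       (cases p; cases s; auto)+
qed

lemma move_shift: "move (a + d, b + e) s = (a + fst (move (d, e) s), b + snd (move (d, e) s))"
  by (cases s) simp_all

lemma ctr_shift: "ctr (a + d, b + e) s = (a + fst (ctr (d, e) s), b + snd (ctr (d, e) s))"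
  by (cases s) simp_all

text \<open>The bound on the abscissa excludes the left extreme point of the circle:
  \<open>over\<close> holds there, but \<open>D_bar\<close> then leads along the lower half.\<close>

lemma over_move:
  assumes "is_center c" "is_center (ctr p s)" "over c p" "fst c - 1 \<le> fst p"
  shows "over c (move p s)"
proof -
  obtain a b d e n m where eq: "c = (a, b)" "p = (a + d, b + e)"
    and nm: "ctr (d, e) s = (4 * n + 2 * m, 2 * m)"
    using center_step_cases[OF assms(1,2)] .
  consider "d = -1" | "d = 0" | "d = 1" | "2 \<le> d"
    using assms(4) by (force simp: eq)
  then show ?thesis
  proof cases
    case 4
    then show ?thesis
      using nm fst_move[of "(d, e)" s] unfolding eq move_shift over_pair by auto
  qed (use nm assms(3) in \<open>unfold eq move_shift over_pair, cases s; simp; presburger\<close>)+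
qed

text \<open>The mirror image of \<open>over_move\<close>; now the right extreme point is
  excluded.\<close>

lemma over_move_back:
  assumes "is_center c" "is_center (ctr p s)" "over c (move p s)" "fst (move p s) \<le> fst c + 1"
  shows "over c p"
proof -
  obtain a b d e n m where eq: "c = (a, b)" "p = (a + d, b + e)"
    and nm: "ctr (d, e) s = (4 * n + 2 * m, 2 * m)"
    using center_step_cases[OF assms(1,2)] .
  have "d \<le> 0"
    using assms(4) fst_move[of p s] by (simp add: eq)
  then consider "d \<le> -3" | "d = -2" | "d = -1" | "d = 0"
    by force
  then show ?thesis
  proof cases
    case 1
    then show ?thesis
      unfolding eq over_pair by auto
  qed (use nm assms(3,4) in \<open>unfold eq move_shift over_pair, cases s; simp; presburger\<close>)+
qed

text \<open>This prepares the comparison of circles: a step meeting the vertical strip of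
  \<open>c\<close> runs on the upper half of \<open>c\<close>, or on another circle that is not
  lower.\<close>

lemma over_ctr:
  assumes "is_center c" "is_center (ctr p s)" "over c p" "over c (move p s)"
    "fst p \<le> fst c + 2" "fst c - 2 \<le> fst (move p s)"
  shows "snd c \<le> snd (ctr p s) \<and> (ctr p s = c \<longrightarrow> upper s)"
proof -
  obtain a b d e n m where eq: "c = (a, b)" "p = (a + d, b + e)"
    and nm: "ctr (d, e) s = (4 * n + 2 * m, 2 * m)"
    using center_step_cases[OF assms(1,2)] .
  \<comment> \<open>A step advances by at most 2, so the strip of width 4 leaves seven relative
    abscissas.\<close>
  have "fst (move p s) \<le> fst p + 2"
    by (cases p; cases s) auto
  then have "-4 \<le> d" "d \<le> 2"
    using assms(5,6) by (simp_all add: eq)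
  then consider "d = -4" | "d = -3" | "d = -2" | "d = -1" | "d = 0" | "d = 1" | "d = 2"
    by force
  then show ?thesis
    by cases (use nm assms(3-6) in \<open>unfold eq move_shift ctr_shift over_pair upper_def,
      cases s; simp; presburger\<close>)+
qed

lemma verts_over_right:
  assumes "is_center c" "centered p w" "over c p" "fst c - 1 \<le> fst p" "v \<in> verts p w"
  shows "over c v"
  using assms(2-5)
proof (induction w arbitrary: p)
  case Nil
  then show ?case
    by simp
next
  case (Cons s w)
  have s: "is_center (ctr p s)" "centered (move p s) w"
    using Cons.prems(1) by simp_all
  have "over c (move p s)"
    using over_move[OF assms(1) s(1)] Cons.prems(2,3) by blast
  moreover have "fst c - 1 \<le> fst (move p s)"
    using Cons.prems(3) fst_move[of p s] by linarith
  moreover have "v = p \<or> v \<in> verts (move p s) w"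
    using Cons.prems(4) by simp
  ultimately show ?case
    using Cons.IH[OF s(2)] Cons.prems(2) by blast
qed

lemma verts_over_left:
  assumes "is_center c" "centered p w" "over c (pos p w)" "fst (pos p w) \<le> fst c + 1"
    "v \<in> verts p w"
  shows "over c v"
  using assms(2-5)
proof (induction w arbitrary: p v)
  case Nil
  then show ?case
    by simp
next
  case (Cons s w)
  have s: "is_center (ctr p s)" "centered (move p s) w"
    and pos: "over c (pos (move p s) w)" "fst (pos (move p s) w) \<le> fst c + 1"
    using Cons.prems(1-3) by simp_all
  have IH: "over c u" if "u \<in> verts (move p s) w" for u
    using Cons.IH[OF s(2) pos that] .
  have "fst (move p s) \<le> fst c + 1"
    using verts_fst_le[OF start_in_verts, of "move p s" w] pos(2) by linarith
  then have "over c p"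
    using over_move_back[OF assms(1) s(1) IH[OF start_in_verts]] by blast
  moreover have "v = p \<or> v \<in> verts (move p s) w"
    using Cons.prems(4) by simp
  ultimately show ?case
    using IH by blast
qed

section \<open>From vertices to curves\<close>

definition above :: "int \<times> int \<Rightarrow> complex set \<Rightarrow> bool" where
  "above c S \<longleftrightarrow> (\<forall>z\<in>sphere (pt c) 2. \<forall>q\<in>S. Re z = Re q \<longrightarrow> Im z \<le> Im q)"

lemma sphere_bounds:
  assumes "z \<in> sphere c r"
  shows "Re c - r \<le> Re z" "Re z \<le> Re c + r" "Im z \<le> Im c + r"
  using abs_Re_le_cmod[of "z - c"] abs_Im_le_cmod[of "z - c"] assms
  by (auto simp: dist_norm norm_minus_commute)

text \<open>The carrying circle is \<open>c\<close> itself, another one at the same level, or a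
  higher one; each position has its own comparison of two circles.\<close>

lemma above_arc:
  assumes c: "is_center c" "is_center (ctr p s)" and over: "over c p" "over c (move p s)"
  shows "above c (step_arc (pt p) s)"
  unfolding above_def
proof (intro ballI impI)
  fix z q
  assume z: "z \<in> sphere (pt c) 2" and q: "q \<in> step_arc (pt p) s" and eq: "Re z = Re q"
  have "real_of_int (fst p) \<le> of_int (fst c + 2)" "of_int (fst c - 2) \<le> real_of_int (fst (move p s))"
    using arc_facts(2,3)[OF q] sphere_bounds[OF z] eq by simp_all
  then have "fst p \<le> fst c + 2" "fst c - 2 \<le> fst (move p s)"
    by (simp_all only: of_int_le_iff)
  then have level: "snd c \<le> snd (ctr p s)" "ctr p s = c \<longrightarrow> upper s"
    using over_ctr[OF c over] by blast+
  show "Im z \<le> Im q"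
  proof (cases "ctr p s = c")
    case True
    then show ?thesis
      using sphere_le_upper_half[OF z] arc_facts(1,4)[OF q] level eq by simp
  next
    case False
    then have dist: "4 \<le> dist (pt c) (pt (ctr p s))"
      using center_dist_ge[OF c] by simp
    show ?thesis
    proof (cases "snd c = snd (ctr p s)")
      case True
      then show ?thesis
        using sphere_level_sphere[OF z arc_facts(1)[OF q] dist] eq by simp
    next
      case False
      then show ?thesis
        using sphere_le_higher_sphere[OF z arc_facts(1)[OF q]] dist level eq by simp
    qed
  qed
qed

text \<open>Serves the end of the path, where the curve of the empty word is a single point.\<close>

lemma above_vertex:
  assumes "over c p"
  shows "above c {pt p}"
  unfolding above_def
proof (intro ballI impI)
  fix z q
  assume z: "z \<in> sphere (pt c) 2" and "q \<in> {pt p}" and "Re z = Re q"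
  then have q: "q = pt p" and Re: "Re z = of_int (fst p)"
    by auto
  define d where "d = fst p - fst c"
  have sq: "real_of_int d ^ 2 = of_int \<bar>d\<bar> ^ 2"
    by simp
  have eq: "of_int d ^ 2 + (Im z - Im (pt c)) ^ 2 = 4"
    using sphere_Re_Im[OF z] by (simp add: Re d_def)
  have "real_of_int \<bar>d\<bar> \<le> of_int 2"
    using sphere_bounds(1,2)[OF z] by (simp add: Re d_def)
  then have "\<bar>d\<bar> \<le> 2"
    by (simp only: of_int_le_iff)
  then consider "\<bar>d\<bar> = 2" | "\<bar>d\<bar> = 1" | "d = 0"
    by linarith
  \<comment> \<open>Here \<open>h\<close> bounds, in levels, how far the circle rises above its
    center at this abscissa: 0 at distance 2, \<open>sqrt 3\<close> at distance 1, and at distance 0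
    the radius 2, rounded up to \<open>2 * sqrt 3\<close>.\<close>
  then have "\<exists>h. Im z \<le> Im (pt c) + sqrt 3 * of_int h \<and> snd c + h \<le> snd p"
  proof cases
    case 1
    have "of_int d ^ 2 = (4::real)"
      unfolding sq 1 by simp
    then show ?thesis
      using eq assms 1 by (intro exI[of _ 0]) (simp add: over_def d_def)
  next
    case 2
    have "of_int d ^ 2 = (1::real)"
      unfolding sq 2 by simp
    then have "(Im z - Im (pt c)) ^ 2 = 3"
      using eq by simp
    then have "Im z - Im (pt c) \<le> sqrt 3"
      by (metis real_le_rsqrt order_refl)
    then show ?thesis
      using assms 2 by (intro exI[of _ 1]) (simp add: over_def d_def)
  next
    case 3
    have "1 \<le> sqrt 3"
      by simp
    then have "Im z \<le> Im (pt c) + sqrt 3 * 2"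
      using sphere_bounds(3)[OF z] by linarith
    then show ?thesis
      using assms 3 by (intro exI[of _ 2]) (simp add: over_def d_def)
  qed
  then obtain h where h: "Im z \<le> sqrt 3 * of_int (snd c + h)" "snd c + h \<le> snd p"
    by (auto simp: distrib_left)
  then have "real_of_int (snd c + h) \<le> of_int (snd p)"
    by (simp only: of_int_le_iff)
  then have "sqrt 3 * real_of_int (snd c + h) \<le> sqrt 3 * of_int (snd p)"
    by (intro mult_left_mono) simp_all
  then show "Im z \<le> Im q"
    using h(1) unfolding q Im_pt by linarith
qed

lemma above_Un: "above c (S \<union> T) \<longleftrightarrow> above c S \<and> above c T"
  by (auto simp: above_def)

lemma above_curve:
  assumes "is_center c" "centered p w" "\<forall>v\<in>verts p w. over c v"
  shows "above c (curve_from (pt p) w)"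
  using assms
proof (induction w arbitrary: p)
  case (Cons s w)
  then show ?case
    using start_in_verts[of "move p s" w] by (simp add: above_Un step_end_pt above_arc)
qed (simp add: above_vertex)

section \<open>Points of contact\<close>

definition on_circle :: "int \<times> int \<Rightarrow> int \<times> int \<Rightarrow> bool" where
  "on_circle c v \<longleftrightarrow>
    v \<in> {(fst c + 2, snd c), (fst c - 2, snd c), (fst c + 1, snd c + 1), (fst c - 1, snd c + 1),
      (fst c + 1, snd c - 1), (fst c - 1, snd c - 1)}"

text \<open>Grid points on the circle are the integer solutions of \<open>d^2 + 3 * e^2 = 4\<close>,
  which forces \<open>e\<close> into -1, 0, 1.\<close>

lemma on_circle_iff: "on_circle c v \<longleftrightarrow> pt v \<in> sphere (pt c) 2"
proof -
  have "pt v \<in> sphere (pt c) 2 \<longleftrightarrow> dist (pt v) (pt c) = 2"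
    by (simp add: dist_commute)
  also have "\<dots> \<longleftrightarrow> dist (pt v) (pt c) ^ 2 = 2 ^ 2"
    by (rule power2_eq_iff_nonneg[symmetric]) simp_all
  also have "\<dots> \<longleftrightarrow> dist (pt v) (pt c) ^ 2 = of_int 4"
    by simp
  also have "\<dots> \<longleftrightarrow> (fst v - fst c) ^ 2 + 3 * (snd v - snd c) ^ 2 = 4"
    unfolding dist_pt by (simp only: of_int_eq_iff)
  finally have iff: "pt v \<in> sphere (pt c) 2 \<longleftrightarrow> (fst v - fst c) ^ 2 + 3 * (snd v - snd c) ^ 2 = 4" .
  have "on_circle c v" if eq: "(fst v - fst c) ^ 2 + 3 * (snd v - snd c) ^ 2 = 4"
  proof -
  define d e where "d = fst v - fst c" and "e = snd v - snd c"
  have eq: "d ^ 2 + 3 * e ^ 2 = 4"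
    using eq by (simp add: d_def e_def)
  have "\<bar>e\<bar> \<le> 1"
  proof (rule ccontr)
    assume "\<not> \<bar>e\<bar> \<le> 1"
    then have "2 ^ 2 \<le> \<bar>e\<bar> ^ 2"
      by (intro power_mono) auto
    then show False
      using eq zero_le_power2[of d] by simp
  qed
  then consider "e = 0" | "e = 1" | "e = -1"
    by linarith
  then have "(d, e) \<in> {(2, 0), (-2, 0), (1, 1), (-1, 1), (1, -1), (-1, -1)}"
  proof cases
    case 1
    then have "d ^ 2 = 2 ^ 2"
      using eq by simp
    then have "d = 2 \<or> d = - 2"
      by (simp only: power2_eq_iff)
    then show ?thesis
      using 1 by auto
  qed (use eq in \<open>auto simp: power2_eq_1_iff\<close>)
  moreover have "v = (fst c + d, snd c + e)"
    by (simp add: d_def e_def)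
  ultimately show "on_circle c v"
    by (auto simp: on_circle_def)
  qed
  moreover have "(fst v - fst c) ^ 2 + 3 * (snd v - snd c) ^ 2 = 4" if "on_circle c v"
    using that by (auto simp: on_circle_def)
  ultimately show ?thesis
    using iff by blast
qed

text \<open>By the parallelogram law for the two radii \<open>a\<close> and \<open>b\<close> ending
  in \<open>q\<close>, a distance of at least 4 between the centers leaves no room for
  \<open>a + b\<close>.\<close>

lemma sphere_tangency:
  fixes c c' q :: complex
  assumes "q \<in> sphere c 2" "q \<in> sphere c' 2" "4 \<le> dist c c'"
  shows "2 * q = c + c'" "dist c c' = 4"
proof -
  define a b where "a = q - c" and "b = q - c'"
  have "norm a ^ 2 = 4" "norm b ^ 2 = 4"
    using assms(1,2) by (simp_all add: a_def b_def dist_norm norm_minus_commute)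
  moreover have "norm (a + b) ^ 2 + norm (a - b) ^ 2 = 2 * norm a ^ 2 + 2 * norm b ^ 2"
    by (simp add: power2_norm_eq_inner inner_add inner_diff inner_commute)
  ultimately have *: "norm (a + b) ^ 2 + norm (a - b) ^ 2 = 16"
    by linarith
  have dist: "norm (a - b) = dist c c'"
    by (simp add: a_def b_def dist_norm norm_minus_commute)
  have "4 ^ 2 \<le> norm (a - b) ^ 2"
    unfolding dist using assms(3) by (rule power_mono) simp
  then have 0: "norm (a + b) ^ 2 = 0"
    using * zero_le_power2[of "norm (a + b)"] by (simp only: power2_eq_square)
  then have "a + b = 0"
    by simp
  moreover have "2 * q - (c + c') = a + b"
    by (simp add: a_def b_def)
  ultimately show "2 * q = c + c'"
    by (metis eq_iff_diff_eq_0)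
  have "dist c c' ^ 2 = 4 ^ 2"
    using * 0 unfolding dist by simp
  then show "dist c c' = 4"
    by (rule power2_eq_imp_eq) simp_all
qed

text \<open>Tangency points cut circles into arcs, so a contact with a different circle can only
  happen at an end of the arc.\<close>

lemma arc_meets_circle:
  assumes c: "is_center c" "is_center (ctr p s)"
    and q: "q \<in> step_arc (pt p) s" "q \<in> sphere (pt c) 2"
  shows "on_circle c p \<or> on_circle c (move p s)"
proof (cases "ctr p s = c")
  case True
  then show ?thesis
    using arc_facts(1)[OF pt_in_arc(1), of p s] by (simp add: on_circle_iff)
next
  case False
  obtain m n where mn: "fst (ctr p s) - fst c = 4 * n + 2 * m" "snd (ctr p s) - snd c = 2 * m"
    using center_differences[OF c] by blast
  have mid: "2 * q = pt c + pt (ctr p s)" and "dist (pt c) (pt (ctr p s)) = 4"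
    using sphere_tangency[OF q(2) arc_facts(1)[OF q(1)]] center_dist_ge[OF c] False by auto
  then have "dist (pt (ctr p s)) (pt c) ^ 2 = of_int 16"
    by (simp add: dist_commute)
  then have "16 = 16 * (n ^ 2 + n * m + m ^ 2)"
    unfolding dist_pt mn hexagonal_norm(1) by (simp only: of_int_eq_iff)
  then have norm: "n ^ 2 + n * m + m ^ 2 = 1"
    by simp
  then have "\<bar>m\<bar> \<le> 1 \<and> \<bar>n\<bar> \<le> 1"
    by (intro hexagonal_norm(2)) simp
  then have "m \<in> {-1, 0, 1}" "n \<in> {-1, 0, 1}"
    by auto
  then have six: "(m, n) \<in> {(0, 1), (0, -1), (1, 0), (-1, 0), (1, -1), (-1, 1)}"
    using norm by auto
  \<comment> \<open>The midpoint of the two centers, in grid coordinates.\<close>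
  define v where "v = (fst (ctr p s) - 2 * n - m, snd (ctr p s) - m)"
  have c_eq: "fst c = fst (ctr p s) - (4 * n + 2 * m)" "snd c = snd (ctr p s) - 2 * m"
    using mn by linarith+
  have v: "q = pt v"
    using arg_cong[OF mid, of Re] arg_cong[OF mid, of Im]
    by (simp add: complex_eq_iff v_def c_eq algebra_simps)
  have "real_of_int (fst p) \<le> of_int (fst v)" "real_of_int (fst v) \<le> of_int (fst (move p s))"
    using arc_facts(2,3)[OF q(1)] by (simp_all add: v)
  then have "fst p \<le> fst v" "fst v \<le> fst (move p s)"
    by (simp_all only: of_int_le_iff)
  \<comment> \<open>The abscissa alone cannot tell the upper tangency points from the lower
    ones.\<close>
  moreover have "upper s \<Longrightarrow> snd (ctr p s) \<le> snd v" "\<not> upper s \<Longrightarrow> snd v \<le> snd (ctr p s)"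
    using arc_facts(4,5)[OF q(1)] by (simp_all add: v)
  ultimately have "v = p \<or> v = move p s"
    using six unfolding v_def upper_def by (cases p; cases s) auto
  then show ?thesis
    using q(2) v by (auto simp: on_circle_iff)
qed

lemma curve_meets_circle:
  assumes "is_center c" "centered p w" "q \<in> curve_from (pt p) w" "q \<in> sphere (pt c) 2"
  shows "\<exists>v\<in>verts p w. on_circle c v"
  using assms(2,3)
proof (induction w arbitrary: p)
  case Nil
  then show ?case
    using assms(4) by (simp add: on_circle_iff)
next
  case (Cons s w)
  show ?case
  proof (cases "q \<in> step_arc (pt p) s")
    case True
    then have "on_circle c p \<or> on_circle c (move p s)"
      using Cons.prems(1) assms(1,4) by (intro arc_meets_circle) auto
    then show ?thesis
      using start_in_verts[of "move p s" w] by auto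
  next
    case False
    then have "\<exists>v\<in>verts (move p s) w. on_circle c v"
      using Cons.prems by (intro Cons.IH) (auto simp: step_end_pt)
    then show ?thesis
      by simp
  qed
qed

section \<open>Kissed circles read off the vertices\<close>

definition kissed :: "(int \<times> int) set \<Rightarrow> (int \<times> int) set" where
  "kissed V = {c. is_center c \<and> ((fst c - 1, snd c + 1) \<in> V \<or> (fst c + 1, snd c + 1) \<in> V)}"

lemma lies_below_iff:
  "lies_below (pt c) w \<longleftrightarrow>
    (\<forall>z\<in>sphere (pt c) 2. 0 \<le> Re z \<and> Re z \<le> width w) \<and> above c (curve w)"
  by (simp add: lies_below_def above_def)

lemma kissed_imp:
  assumes w: "packing_path w" and c: "c \<in> kissed (verts (0, 0) w)"
  shows "0 \<le> Im (pt c) \<and> lies_below (pt c) w \<and> sphere (pt c) 2 \<inter> curve w \<noteq> {}"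
proof -
  have w: "centered (0, 0) w" "\<forall>v\<in>verts (0, 0) w. 0 \<le> snd v" "snd (pos (0, 0) w) = 0"
    using w by (simp_all add: packing_path_iff)
  have center: "is_center c"
    using c by (simp add: kissed_def)
  from c obtain v where v: "v \<in> verts (0, 0) w" "v = (fst c - 1, snd c + 1) \<or> v = (fst c + 1, snd c + 1)"
    unfolding kissed_def by blast
  then have "0 \<le> snd c + 1"
    using w(2) by auto
  then have level: "0 \<le> snd c"
    using center unfolding is_center_def by presburger
  have over: "over c v"
    using v(2) by (auto simp: over_def)
  \<comment> \<open>The contact \<open>v\<close> is the seed: \<open>over\<close> spreads leftwards
    through \<open>u\<close> and rightwards through \<open>r\<close>.\<close>
  obtain u r where ur: "w = u @ r" "v = pos (0, 0) u"
    using verts_split[OF v(1)] .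
  have centered: "centered (0, 0) u" "centered v r"
    using w(1) by (simp_all add: ur centered_append)
  have "over c v'" if "v' \<in> verts (0, 0) u" for v'
    using verts_over_left[OF center centered(1) _ _ that] over v(2) by (auto simp flip: ur(2))
  moreover have "over c v'" if "v' \<in> verts v r" for v'
    using verts_over_right[OF center centered(2) over _ that] v(2) by auto
  ultimately have "\<forall>v'\<in>verts (0, 0) w. over c v'"
    by (auto simp: ur(1) verts_append simp flip: ur(2))
  then have overs: "above c (curve w)" "over c (0, 0)" "over c (pos (0, 0) w)"
    using above_curve[OF center w(1)] start_in_verts pos_in_verts by (auto simp: pt_0)
  have "0 \<le> fst v" "fst v \<le> fst (pos (0, 0) w)"
    using verts_fst_ge[OF v(1)] verts_fst_le[OF v(1)] by simp_all
  \<comment> \<open>Both ends of the path have level 0, and \<open>c\<close> has level at least 0,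
    so \<open>over\<close> forbids them at abscissa distance 0 or 1 from \<open>c\<close>.\<close>
  then have "2 \<le> fst c" "fst c + 2 \<le> fst (pos (0, 0) w)"
    using overs(2,3) v(2) level w(3) unfolding over_def by auto
  then have "2 \<le> Re (pt c)" "Re (pt c) + 2 \<le> width w"
    by (simp_all add: width_eq)
  then have "lies_below (pt c) w"
    using overs(1) sphere_bounds(1,2)[of _ "pt c" 2] unfolding lies_below_iff by fastforce
  moreover have "pt v \<in> sphere (pt c) 2 \<inter> curve w"
    using verts_in_curve[OF v(1)] v(2) on_circle_iff[of c v] by (auto simp: pt_0 on_circle_def)
  ultimately show ?thesis
    using level by auto
qed

lemma imp_kissed:
  assumes w: "centered (0, 0) w" and c: "is_center c"
    and below: "lies_below (pt c) w" and meets: "sphere (pt c) 2 \<inter> curve w \<noteq> {}"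
  shows "c \<in> kissed (verts (0, 0) w)"
proof -
  have above: "above c (curve w)" and range: "\<forall>z\<in>sphere (pt c) 2. 0 \<le> Re z \<and> Re z \<le> width w"
    using below by (simp_all add: lies_below_iff)
  \<comment> \<open>Directly above each lower tangency point the circle has an upper one,
    contradicting \<open>above\<close>.\<close>
  have not_low: "(fst c + 1, snd c - 1) \<notin> verts (0, 0) w" "(fst c - 1, snd c - 1) \<notin> verts (0, 0) w"
  proof -
    have "False" if "(a, snd c - 1) \<in> verts (0, 0) w" "on_circle c (a, snd c + 1)" for a
    proof -
      have "pt (a, snd c - 1) \<in> curve w" "pt (a, snd c + 1) \<in> sphere (pt c) 2"
        using verts_in_curve[OF that(1)] that(2) by (simp_all only: pt_0 on_circle_iff)
      then have "Im (pt (a, snd c + 1)) \<le> Im (pt (a, snd c - 1))"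
        using above unfolding above_def by fastforce
      then show False
        by simp
    qed
    then show "(fst c + 1, snd c - 1) \<notin> verts (0, 0) w" "(fst c - 1, snd c - 1) \<notin> verts (0, 0) w"
      by (auto simp: on_circle_def)
  qed
  obtain v where v: "v \<in> verts (0, 0) w" "on_circle c v"
    using curve_meets_circle[OF c w, unfolded pt_0] meets by blast
  obtain u r where ur: "w = u @ r" "v = pos (0, 0) u"
    using verts_split[OF v(1)] .
  \<comment> \<open>The right extreme point can only be entered along an arc of the circle itself,
    which starts at an upper or a lower tangency point. If the path starts there, the circle reaches
    to negative abscissas.\<close>
  have "\<exists>b\<in>{1, -1}. (fst c + 1, snd c + b) \<in> verts (0, 0) w" if v_eq: "v = (fst c + 2, snd c)"
  proof (cases u rule: rev_cases)
    case Nil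
    then have "fst c = -2"
      using ur v_eq by simp
    moreover have "pt (fst c - 2, snd c) \<in> sphere (pt c) 2"
      unfolding on_circle_iff[symmetric] by (simp add: on_circle_def)
    then have "0 \<le> Re (pt (fst c - 2, snd c))"
      using range by blast
    ultimately show ?thesis
      by simp
  next
    case (snoc u' s)
    define p where "p = pos (0, 0) u'"
    have "is_center (ctr p s)" "move p s = (fst c + 2, snd c)"
      using w v_eq unfolding ur snoc p_def by (simp_all add: centered_append)
    then have "p = (fst c + 1, snd c + 1) \<or> p = (fst c + 1, snd c - 1)"
      using c unfolding is_center_def by (cases p; cases s; simp; presburger)
    moreover have "p \<in> verts (0, 0) w"
      using pos_in_verts[of "(0, 0)" u'] unfolding ur snoc p_def by (simp add: verts_append)
    ultimately show ?thesis
      by auto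
  qed
  \<comment> \<open>Symmetrically, the left extreme point is left along an arc of the circle, or the
    path ends there and the circle protrudes to the right.\<close>
  moreover have "\<exists>b\<in>{1, -1}. (fst c - 1, snd c + b) \<in> verts (0, 0) w" if v_eq: "v = (fst c - 2, snd c)"
  proof (cases r)
    case Nil
    then have "pos (0, 0) w = (fst c - 2, snd c)"
      using ur v_eq by (metis append_Nil2)
    then have "width w = of_int (fst c - 2)"
      by (simp add: width_eq)
    moreover have "pt (fst c + 2, snd c) \<in> sphere (pt c) 2"
      unfolding on_circle_iff[symmetric] by (simp add: on_circle_def)
    then have "Re (pt (fst c + 2, snd c)) \<le> width w"
      using range by blast
    ultimately show ?thesis
      by simp
  next
    case (Cons s r')
    have "is_center (ctr v s)"
      using w unfolding ur(1) Cons by (simp add: centered_append ur(2))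
    then have "move v s = (fst c - 1, snd c + 1) \<or> move v s = (fst c - 1, snd c - 1)"
      using c v_eq unfolding is_center_def by (cases s; simp; presburger)
    moreover have "move v s \<in> verts (0, 0) w"
      using start_in_verts[of "move v s" r'] unfolding ur(1) Cons
      by (simp add: verts_append ur(2))
    ultimately show ?thesis
      by auto
  qed
  ultimately show ?thesis
    using v c not_low by (auto simp: kissed_def on_circle_def)
qed

lemma kiss_eq:
  assumes "packing_path w"
  shows "kiss w = card (kissed (verts (0, 0) w))"
proof -
  have "{c \<in> centers. 0 \<le> Im c \<and> lies_below c w \<and> sphere c 2 \<inter> curve w \<noteq> {}} =
      pt ` kissed (verts (0, 0) w)"
    using kissed_imp[OF assms] imp_kissed[of w] assms
    by (fastforce simp: centers_eq packing_path_iff kissed_def)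
  then show ?thesis
    using inj_pt by (simp add: kiss_def card_image inj_on_subset)
qed

section \<open>Inchworm paths and binary trees\<close>

definition compatible :: "step \<Rightarrow> step \<Rightarrow> bool" where
  "compatible s s' \<longleftrightarrow> \<not> (s = U_bar \<and> s' = D_bar) \<and> \<not> (s = D \<and> s' = U)"

lemma successively_compatible_iff:
  "successively compatible w \<longleftrightarrow> \<not> sublist [U_bar, D_bar] w \<and> \<not> sublist [D, U] w"
proof (induction w)
  case (Cons s w)
  then show ?case
    by (cases w) (auto simp: compatible_def sublist_Cons_right)
qed simp

text \<open>What remains of an inchworm path from the vertex \<open>p\<close> on; parsing proceeds
  along such suffixes.\<close>

definition completion :: "int \<times> int \<Rightarrow> step list \<Rightarrow> bool" where
  "completion p w \<longleftrightarrow> centered p w \<and> (\<forall>v\<in>verts p w. 0 \<le> snd v) \<and> snd (pos p w) = 0 \<and>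
    successively compatible w"

lemma inchworm_iff: "inchworm w \<longleftrightarrow> completion (0, 0) w"
  by (auto simp: inchworm_def completion_def packing_path_iff successively_compatible_iff)

lemma completion_Cons:
  assumes "completion p (s # w)"
  shows "is_center (ctr p s)" "completion (move p s) w" "0 \<le> snd p"
    "w \<noteq> [] \<Longrightarrow> compatible s (hd w)"
  using assms by (auto simp: completion_def successively_Cons)

lemma completion_append: "completion p (u @ v) \<Longrightarrow> completion (pos p u) v"
proof (induction u arbitrary: p)
  case (Cons s u)
  then show ?case
    using completion_Cons(2)[of p s "u @ v"] by simp
qed simp

lemma completion_nonneg: "completion p w \<Longrightarrow> 0 \<le> snd p"
  using start_in_verts[of p w] by (auto simp: completion_def)

lemma completion_Nil: "completion p [] \<Longrightarrow> snd p = 0"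
  by (simp add: completion_def)

section \<open>From inchworm paths to trees\<close>

definition left_top :: "int \<times> int \<Rightarrow> bool" where
  "left_top p \<longleftrightarrow> odd (snd p) \<and> (fst p - snd p) mod 4 = 0"

definition right_top :: "int \<times> int \<Rightarrow> bool" where
  "right_top p \<longleftrightarrow> odd (snd p) \<and> (fst p - snd p) mod 4 = 2"

text \<open>Such a point is at 120 degrees on one circle and at 300 degrees on another, where
  \<open>F\<close> and \<open>U_bar\<close> start. A \<open>right_top\<close> point is likewise at
  60 and at 240 degrees.\<close>

lemma center_left_top: "left_top p \<Longrightarrow> is_center (ctr p s) \<longleftrightarrow> s = F \<or> s = U_bar"
  unfolding left_top_def is_center_def by (cases p; cases s; simp; presburger)

lemma center_right_top: "right_top p \<Longrightarrow> is_center (ctr p s) \<longleftrightarrow> s = D \<or> s = F_bar"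
  unfolding right_top_def is_center_def by (cases p; cases s; simp; presburger)

lemma center_side: "even (snd p) \<Longrightarrow> is_center (ctr p s) \<Longrightarrow> s = U \<or> s = D_bar"
  unfolding is_center_def by (cases p; cases s; simp)

lemma right_top_cases:
  assumes "completion p w" "right_top p"
  obtains r where "w = D # r" | r where "w = F_bar # r"
proof (cases w)
  case Nil
  then show ?thesis
    using assms completion_Nil unfolding right_top_def by fastforce
next
  case (Cons s r)
  then show ?thesis
    using that assms center_right_top completion_Cons(1) by blast
qed

text \<open>The avoided patterns act here: the circles leave \<open>U\<close> and
  \<open>D_bar\<close>, compatibility removes the turn, and a positive level prevents the path from
  stopping.\<close>

lemma side_cases:
  assumes "completion p (s # w)" "even (snd (move p s))" "0 < snd (move p s)" "s \<in> {U_bar, D}"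
  obtains r where "w = (if s = U_bar then U else D_bar) # r"
proof (cases w)
  case Nil
  then show ?thesis
    using assms completion_Nil[of "move p s"] completion_Cons(2)[OF assms(1)] by simp
next
  case (Cons s' r)
  then have "s' = U \<or> s' = D_bar"
    using completion_Cons(1) completion_Cons(2)[OF assms(1)] center_side assms(2) by blast
  then show ?thesis
    using completion_Cons(4)[OF assms(1)] assms(4) that Cons by (auto simp: compatible_def)
qed

text \<open>The first-return decomposition "up \<open>P\<close> down \<open>Q\<close>" of a Dyck
  path, recorded as the moves between consecutive midpoints of steps. The empty tree has no
  midpoint, so it is treated apart; \<open>word\<close> adds the half steps at both ends.\<close>

fun body :: "dtree \<Rightarrow> step list" where
  "body E = []"
| "body (N P Q) = (if P = E then [F] else [U_bar, U] @ body P @ [D, D_bar]) @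
    (if Q = E then [] else F_bar # body Q)"

definition word :: "dtree \<Rightarrow> step list" where
  "word t = (if t = E then [] else U # body t @ [D])"

lemma weight_mod_4: "weight t mod 4 = 0"
  by (induction t) (auto simp: mod_add_eq[symmetric])

lemma four_dvd_weight: "4 dvd int (weight t)"
  using weight_mod_4[of t] by presburger

text \<open>A tree with \<open>n\<close> nodes has \<open>2 * n\<close> midpoints and thus
  \<open>2 * n - 1\<close> gaps of width 2; this explains the -2.\<close>

lemma pos_body: "t \<noteq> E \<Longrightarrow> pos (a, b) (body t) = (a + int (weight t) - 2, b)"
  by (induction t arbitrary: a b) auto

text \<open>The \<open>D\<close> after the body is a delimiter: it starts the descent to the
  enclosing component or to the axis. Strong induction on the length allows both subtrees to be
  parsed in turn.\<close>

lemma parse_body: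
  assumes "completion p w" "left_top p"
  obtains t r where "t \<noteq> E" "w = body t @ D # r"
  using assms
proof (induction w arbitrary: p thesis rule: length_induct)
  case (1 w)
  note IH = 1(1) and completion = 1(3) and left = 1(4)
  obtain a b where p: "p = (a, b)"
    by (cases p)
  have b: "odd b" "0 < b" "(a - b) mod 4 = 0"
    using left completion_nonneg[OF completion] unfolding left_top_def p by (auto simp: order_less_le)
  \<comment> \<open>After a component, \<open>F_bar\<close> opens its right neighbour, whereas
    \<open>D\<close> closes the list of siblings.\<close>
  have tail: "\<exists>Q r. w2 = (if Q = E then [] else F_bar # body Q) @ D # r"
    if "completion q w2" "right_top q" "length w2 < length w" for q w2
    using that(1,2)
  proof (cases rule: right_top_cases)
    case (1 r)
    then show ?thesis
      by (intro exI[of _ E] exI[of _ r]) simp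
  next
    case (2 w3)
    have "left_top (move q F_bar)"
      using that(2) unfolding left_top_def right_top_def by (cases q) (simp, presburger)
    moreover have "completion (move q F_bar) w3"
      using that(1) completion_Cons(2) 2 by blast
    moreover have "length w3 < length w"
      using that(3) 2 by simp
    ultimately obtain Q r where "Q \<noteq> E" "w3 = body Q @ D # r"
      using IH by blast
    then show ?thesis
      using 2 by (intro exI[of _ Q] exI[of _ r]) simp
  qed
  obtain s w1 where w: "w = s # w1"
    using completion completion_Nil[of p] b(2) p by (cases w) auto
  have "s = F \<or> s = U_bar"
    using completion_Cons(1)[of p s w1] completion center_left_top[OF left] w by blast
  then show ?case
  proof
    assume s: "s = F"
    have "right_top (move p F)"
      using b unfolding right_top_def p by (simp, presburger)
    moreover have "completion (move p F) w1"
      using completion_Cons(2) completion w s by blast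
    ultimately obtain Q r where "w1 = (if Q = E then [] else F_bar # body Q) @ D # r"
      using tail[of "move p F" w1] w by auto
    then show ?thesis
      using 1(2)[of "N E Q" r] w s by simp
  next
    assume s: "s = U_bar"
    obtain w2 where w1: "w1 = U # w2"
      using side_cases[of p U_bar w1] completion b unfolding w s p by auto
    have "completion (pos p [U_bar, U]) w2"
      using completion_append[of p "[U_bar, U]" w2] completion w s w1 by simp
    then have w2: "completion (a + 2, b + 2) w2"
      by (simp add: p add.commute)
    have "left_top (a + 2, b + 2)"
      using b unfolding left_top_def by simp
    then obtain P r where P: "P \<noteq> E" "w2 = body P @ D # r"
      using IH w2 w w1 by (metis length_Cons lessI less_SucI)
    have "completion (pos (a + 2, b + 2) (body P)) (D # r)"
      using completion_append w2 P(2) by blast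
    \<comment> \<open>The offset 2 of the start cancels the -2 of \<open>pos_body\<close>.\<close>
    then have r: "completion (a + int (weight P), b + 2) (D # r)"
      using pos_body[OF P(1)] by simp
    then obtain r' where r': "r = D_bar # r'"
      using side_cases[of _ D r] b by fastforce
    have "completion (pos (a + int (weight P), b + 2) [D, D_bar]) r'"
      using completion_append[of "(a + int (weight P), b + 2)" "[D, D_bar]" r'] r r' by simp
    moreover have "pos (a + int (weight P), b + 2) [D, D_bar] = (a + int (weight P) + 2, b)"
      by simp
    moreover have "right_top (a + int (weight P) + 2, b)"
      using b four_dvd_weight[of P] unfolding right_top_def by simp presburger
    moreover have "length r' < length w"
      using w w1 P(2) r' by simp
    ultimately obtain Q r'' where "r' = (if Q = E then [] else F_bar # body Q) @ D # r''"
      using tail by metis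
    then show ?thesis
      using 1(2)[of "N P Q" r''] P r' w w1 s by simp
  qed
qed

lemma inchworm_imp_word:
  assumes "inchworm w"
  shows "w \<in> range word"
proof (cases w)
  case Nil
  then have "w = word E"
    by (simp add: word_def)
  then show ?thesis
    by blast
next
  case (Cons s v)
  have w: "completion (0, 0) (s # v)"
    using assms Cons by (simp add: inchworm_iff)
  have "s = U"
    using center_side[of "(0, 0)" s] completion_Cons(1,2)[OF w] completion_nonneg[of "(1, -1)" v] by auto
  then have v: "completion (1, 1) v"
    using completion_Cons(2)[OF w] by simp
  then obtain t r where t: "t \<noteq> E" "v = body t @ D # r"
    by (rule parse_body) (auto simp: left_top_def)
  have "completion (pos (1, 1) (body t)) (D # r)"
    using completion_append v t(2) by blast
  then have Dr: "completion (int (weight t) - 1, 1) (D # r)"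
    using pos_body[OF t(1), of 1 1] by simp
  \<comment> \<open>On the axis, \<open>U\<close> would complete the avoided pattern
    \<open>DU\<close>, and \<open>D_bar\<close> would go below ordinate 0.\<close>
  have "r = []"
  proof (rule ccontr)
    assume "r \<noteq> []"
    then obtain s' r' where r: "r = s' # r'"
      by (cases r) auto
    have r': "completion (int (weight t), 0) (s' # r')"
      using completion_Cons(2)[OF Dr] r by simp
    then have "s' = U \<or> s' = D_bar"
      using center_side completion_Cons(1) by fastforce
    moreover have "s' \<noteq> U"
      using completion_Cons(4)[OF Dr] r by (auto simp: compatible_def)
    ultimately have "s' = D_bar"
      by blast
    then show False
      using completion_nonneg[OF completion_Cons(2)[OF r']] by simp
  qed
  then have "w = word t"
    using Cons \<open>s = U\<close> t by (simp add: word_def)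
  then show ?thesis
    by blast
qed

section \<open>From trees to inchworm paths\<close>

lemma body_eq_Nil: "body t = [] \<longleftrightarrow> t = E"
  by (cases t) auto

text \<open>These letters control the joints: no avoided pattern arises where pieces are put
  together, and no body can be mistaken for the delimiter \<open>D\<close>.\<close>

lemma body_ends:
  assumes "t \<noteq> E"
  shows "body t \<noteq> []" "hd (body t) \<in> {F, U_bar}" "last (body t) \<in> {F, D_bar}"
proof -
  show "body t \<noteq> []" "hd (body t) \<in> {F, U_bar}"
    using assms by (cases t; simp)+
  show "last (body t) \<in> {F, D_bar}"
    using assms by (induction t) (auto simp: last_append body_eq_Nil)
qed

lemma compatible_body: "successively compatible (body t)"
proof (induction t)
  case (N P Q)
  then show ?case
    using body_ends[of P] body_ends[of Q]
    by (auto simp: successively_append_iff successively_Cons compatible_def)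
qed simp

definition core :: "dtree \<Rightarrow> step list" where
  "core P = (if P = E then [F] else [U_bar, U] @ body P @ [D, D_bar])"

lemma body_N: "body (N P Q) = core P @ (if Q = E then [] else F_bar # body Q)"
  by (simp add: core_def)

lemma pos_core: "pos (a, b) (core P) = (a + int (weight P) + 2, b)"
  using pos_body[of P "a + 2" "b + 2"] by (simp add: core_def add.commute)

lemma verts_core:
  "verts (a, b) (core P) =
    (if P = E then {(a, b), (a + 2, b)}
     else {(a, b), (a + 1, b + 1), (a + int (weight P) + 1, b + 1), (a + int (weight P) + 2, b)} \<union>
       verts (a + 2, b + 2) (body P))"
  using pos_body[of P "a + 2" "b + 2"] pos_in_verts[of "(a + 2, b + 2)" "body P"]
  by (auto simp: core_def verts_append add.commute)

lemma verts_body_N: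
  "verts (a, b) (body (N P Q)) = verts (a, b) (core P) \<union>
    (if Q = E then {} else verts (a + int (weight P) + 4, b) (body Q))"
  unfolding body_N using pos_in_verts[of "(a, b)" "core P"]
  by (auto simp: verts_append pos_core add.commute)

lemma centered_body:
  assumes "left_top (a, b)" "t \<noteq> E"
  shows "centered (a, b) (body t)"
  using assms
proof (induction t arbitrary: a b)
  case (N P Q)
  have next_left: "left_top (a + 2, b + 2)" "left_top (a + int (weight P) + 4, b)"
    using N.prems(1) four_dvd_weight[of P] unfolding left_top_def by (simp_all, presburger+)
  have centers: "is_center (ctr (a, b) F)" "is_center (ctr (a, b) U_bar)"
    "is_center (ctr (a + 1, b + 1) U)"
    "is_center (ctr (a + int (weight P), b + 2) D)"
    "is_center (ctr (a + int (weight P) + 1, b + 1) D_bar)"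
    "is_center (ctr (a + int (weight P) + 2, b) F_bar)"
    using N.prems(1) four_dvd_weight[of P] unfolding left_top_def is_center_def
    by (simp_all, presburger+)
  have "centered (a, b) (core P)"
    using centers N.IH(1)[OF next_left(1)] pos_body[of P "a + 2" "b + 2"]
    by (auto simp: core_def centered_append add.commute)
  then show ?case
    unfolding body_N using centers(6) N.IH(2)[OF next_left(2)]
    by (auto simp: centered_append pos_core add.commute)
qed simp

lemma verts_body_ge:
  assumes "t \<noteq> E" "v \<in> verts (a, b) (body t)"
  shows "b \<le> snd v"
  using assms
proof (induction t arbitrary: a b v)
  case (N P Q)
  have "b \<le> snd v" if "v \<in> verts (a + 2, b + 2) (body P)" "P \<noteq> E"
    using N.IH(1)[OF that(2,1)] by simp
  moreover have "b \<le> snd v" if "v \<in> verts (a + int (weight P) + 4, b) (body Q)" "Q \<noteq> E"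
    using N.IH(2)[OF that(2,1)] .
  ultimately show ?case
    using N.prems(2) unfolding verts_body_N verts_core by (auto split: if_splits)
qed simp

lemma inchworm_word: "inchworm (word t)"
proof (cases "t = E")
  case True
  then show ?thesis
    by (simp add: word_def inchworm_iff completion_def)
next
  case False
  have "(int (weight t) - 2) mod 4 = 2"
    using four_dvd_weight[of t] by presburger
  then have "is_center (ctr (int (weight t) - 1, 1) D)"
    by (simp add: is_center_def)
  then have "centered (0, 0) (word t)"
    using False centered_body[of 1 1 t] pos_body[of t 1 1]
    by (simp add: word_def centered_append left_top_def is_center_def)
  moreover have "\<forall>v\<in>verts (0, 0) (word t). 0 \<le> snd v" "snd (pos (0, 0) (word t)) = 0"
    using False pos_body[of t 1 1] verts_body_ge[OF False, of _ 1 1]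
    by (fastforce simp: word_def verts_append)+
  moreover have "successively compatible (word t)"
    using False compatible_body[of t] body_ends[of t]
    by (auto simp: word_def successively_append_iff successively_Cons compatible_def)
  ultimately show ?thesis
    by (simp add: inchworm_iff completion_def)
qed

text \<open>The next letter decides every choice: \<open>F\<close> or \<open>U_bar\<close> for the
  left subtree, \<open>F_bar\<close> or \<open>D\<close> for the right one. The remainders are
  arbitrary because the body of \<open>P\<close> is followed by more of the same word.\<close>

lemma body_parse_unique: "body t @ D # r = body t' @ D # r' \<Longrightarrow> t = t' \<and> r = r'"
proof (induction t arbitrary: t' r r')
  case E
  have "t' = E"
  proof (rule ccontr)
    assume t': "t' \<noteq> E"
    have "hd (body t' @ D # r') = D"
      using arg_cong[OF E, of hd] by simp
    then show False
      using body_ends(1,2)[OF t'] by simp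
  qed
  then show ?case
    using E by simp
next
  case (N P Q)
  have "t' \<noteq> E"
  proof
    assume "t' = E"
    then have "hd (body (N P Q) @ D # r) = D"
      using arg_cong[OF N.prems, of hd] by simp
    then show False
      using body_ends(1,2)[of "N P Q"] by simp
  qed
  then obtain P' Q' where t': "t' = N P' Q'"
    by (cases t') auto
  define tail where "tail = (\<lambda>Q. if Q = E then [] else F_bar # body Q)"
  have tail: "Q = Q' \<and> r = r'" if "tail Q @ D # r = tail Q' @ D # r'"
  proof (cases "Q = E \<or> Q' = E")
    case True
    then show ?thesis
      using that by (auto simp: tail_def split: if_splits)
  next
    case False
    then have "body Q @ D # r = body Q' @ D # r'"
      using that by (simp add: tail_def)
    then show ?thesis
      by (rule N.IH(2))
  qed
  have body: "body (N P Q) = core P @ tail Q" for P Q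
    by (simp only: body_N tail_def)
  have eq: "core P @ tail Q @ D # r = core P' @ tail Q' @ D # r'"
    using N.prems unfolding t' body by simp
  show ?case
  proof (cases "P = E \<or> P' = E")
    case True
    then have "P = P'" "tail Q @ D # r = tail Q' @ D # r'"
      using eq by (simp_all add: core_def split: if_splits)
    then show ?thesis
      using tail t' by simp
  next
    case False
    then have "body P @ D # (D_bar # tail Q @ D # r) = body P' @ D # (D_bar # tail Q' @ D # r')"
      using eq by (simp add: core_def)
    then have "P = P' \<and> D_bar # tail Q @ D # r = D_bar # tail Q' @ D # r'"
      by (rule N.IH(1))
    then show ?thesis
      using tail t' by simp
  qed
qed

lemma bij_word: "bij_betw word UNIV {w. inchworm w}"
proof (rule bij_betw_imageI)
  show "inj word"
    using body_parse_unique[of _ "[]" _ "[]"] by (auto simp: inj_def word_def split: if_splits)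
  show "range word = {w. inchworm w}"
    using inchworm_imp_word inchworm_word by auto
qed

lemma width_word: "width (word t) = of_nat (weight t)"
  using pos_body[of t 1 1] by (simp add: width_eq word_def)

section \<open>Counting the kissed circles of a tree\<close>

lemma kissed_Un: "kissed (V \<union> V') = kissed V \<union> kissed V'"
  by (auto simp: kissed_def)

lemma kissed_left_top: "left_top (a, b) \<Longrightarrow> kissed {(a, b)} = {(a + 1, b - 1)}"
  unfolding kissed_def left_top_def is_center_def by (auto; presburger)

lemma kissed_right_top: "right_top (a, b) \<Longrightarrow> kissed {(a, b)} = {(a - 1, b - 1)}"
  unfolding kissed_def right_top_def is_center_def by (auto; presburger)

lemma kissed_side: "even b \<Longrightarrow> kissed {(a, b)} = {}"
  unfolding kissed_def is_center_def by auto

text \<open>The counts add up only if the circles of different parts are distinct; the interval of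
  abscissas in the third claim carries this through the induction.\<close>

lemma kissed_body:
  assumes "left_top (a, b)" "t \<noteq> E"
  shows "finite (kissed (verts (a, b) (body t)))"
    and "card (kissed (verts (a, b) (body t))) = kisses t"
    and "fst ` kissed (verts (a, b) (body t)) \<subseteq> {a + 1..a + int (weight t) - 3}"
proof -
  have "finite (kissed (verts (a, b) (body t))) \<and>
    card (kissed (verts (a, b) (body t))) = kisses t \<and>
    fst ` kissed (verts (a, b) (body t)) \<subseteq> {a + 1..a + int (weight t) - 3}"
    using assms
  proof (induction t arbitrary: a b)
    case (N P Q)
    \<comment> \<open>The abscissa of the last midpoint of the first component; the body of
      \<open>Q\<close> starts at \<open>m + 2\<close>.\<close>
    define m where "m = a + int (weight P) + 2"
    have tops: "left_top (a + 2, b + 2)" "left_top (m + 2, b)" "right_top (m, b)" "even (b + 1)"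
      using N.prems(1) four_dvd_weight[of P] unfolding left_top_def right_top_def m_def
      by (simp_all, presburger+)
    let ?K = "kissed (verts (a, b) (core P))"
    have core: "finite ?K \<and> card ?K = (if P = E then 1 else 2) + kisses P \<and> fst ` ?K \<subseteq> {a + 1..m - 1}"
    proof (cases "P = E")
      case True
      then have "verts (a, b) (core P) = {(a, b)} \<union> {(m, b)}"
        by (auto simp: verts_core m_def)
      \<comment> \<open>At a peak both midpoints lie on the same circle.\<close>
      then have "?K = {(a + 1, b - 1)}"
        using kissed_left_top[OF N.prems(1)] kissed_right_top[OF tops(3)] True
        by (simp only: kissed_Un) (simp add: m_def)
      then show ?thesis
        using True by (simp add: m_def)
    next
      case False
      let ?KP = "kissed (verts (a + 2, b + 2) (body P))"
      have "verts (a, b) (core P) =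
          {(a, b)} \<union> {(a + 1, b + 1)} \<union> verts (a + 2, b + 2) (body P) \<union> {(m - 1, b + 1)} \<union> {(m, b)}"
        using False by (auto simp: verts_core m_def)
      then have K: "?K = insert (a + 1, b - 1) (insert (m - 1, b - 1) ?KP)"
        using kissed_left_top[OF N.prems(1)] kissed_right_top[OF tops(3)] kissed_side[OF tops(4)]
        by (simp only: kissed_Un) auto
      have IH: "finite ?KP" "card ?KP = kisses P" "fst ` ?KP \<subseteq> {a + 3..m - 3}"
        using N.IH(1)[OF tops(1) False] by (simp_all add: m_def add.commute)
      then have new: "(a + 1, b - 1) \<notin> ?KP" "(m - 1, b - 1) \<notin> ?KP"
        by force+
      \<comment> \<open>A nonempty left subtree separates the two circles of the root.\<close>
      have "0 < weight P"
        using False by (cases P) auto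
      then have "a + 1 < m - 1"
        by (simp add: m_def)
      then have "card ?K = 2 + kisses P" "fst ` ?K \<subseteq> {a + 1..m - 1}"
        using IH new unfolding K by fastforce+
      then show ?thesis
        using False IH(1) K by simp
    qed
    show ?case
    proof (cases "Q = E")
      case True
      then have "verts (a, b) (body (N P Q)) = verts (a, b) (core P)"
        by (simp add: verts_body_N del: body.simps)
      then show ?thesis
        using core True by (simp add: m_def)
    next
      case False
      let ?KQ = "kissed (verts (m + 2, b) (body Q))"
      have "verts (a, b) (body (N P Q)) = verts (a, b) (core P) \<union> verts (m + 2, b) (body Q)"
        using False by (simp add: verts_body_N m_def add.commute add.left_commute del: body.simps)
      then have K: "kissed (verts (a, b) (body (N P Q))) = ?K \<union> ?KQ"
        by (simp only: kissed_Un)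
      have IH: "finite ?KQ" "card ?KQ = kisses Q" "fst ` ?KQ \<subseteq> {m + 3..m + int (weight Q) - 1}"
        using N.IH(2)[OF tops(2) False] by (simp_all add: add.commute)
      have "?K \<inter> ?KQ = {}"
        using core IH(3) by fastforce
      then have "card (?K \<union> ?KQ) = (if P = E then 1 else 2) + kisses P + kisses Q"
        using core IH by (simp add: card_Un_disjoint)
      moreover have "0 < weight Q"
        using False by (cases Q) auto
      then have "fst ` (?K \<union> ?KQ) \<subseteq> {a + 1..a + int (weight (N P Q)) - 3}"
        using core IH(3) by (fastforce simp: m_def image_Un)
      ultimately show ?thesis
        using core IH(1) unfolding K by simp
    qed
  qed simp
  then show "finite (kissed (verts (a, b) (body t)))"
    "card (kissed (verts (a, b) (body t))) = kisses t"
    "fst ` kissed (verts (a, b) (body t)) \<subseteq> {a + 1..a + int (weight t) - 3}"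
    by blast+
qed

lemma kiss_word: "kiss (word t) = kisses t"
proof -
  have kiss: "kiss (word t) = card (kissed (verts (0, 0) (word t)))"
    using kiss_eq inchworm_word unfolding inchworm_def by blast
  show ?thesis
  proof (cases "t = E")
    case True
    then show ?thesis
      using kiss kissed_side[of 0 0] by (simp add: word_def)
  next
    case False
    have "verts (0, 0) (word t) = {(0, 0)} \<union> verts (1, 1) (body t) \<union> {(int (weight t), 0)}"
      using False pos_body[of t 1 1] pos_in_verts[of "(1, 1)" "body t"]
      by (auto simp: word_def verts_append)
    then have "kissed (verts (0, 0) (word t)) = kissed (verts (1, 1) (body t))"
      by (simp only: kissed_Un) (simp add: kissed_side)
    then show ?thesis
      using kiss kissed_body(2)[of 1 1 t] False by (simp add: left_top_def)
  qed
qed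

lemma inchworm_gf_eq: "inchworm_gf = tree_gf UNIV"
proof -
  have "card {w. inchworm w \<and> width w = of_nat n \<and> kiss w = k} =
      card {t \<in> UNIV. weight t = n \<and> kisses t = k}" for n k
  proof -
    have "{w. inchworm w \<and> width w = of_nat n \<and> kiss w = k} = word ` {t \<in> UNIV. weight t = n \<and> kisses t = k}"
      (is "?W = ?T")
    proof (intro set_eqI iffI)
      fix w
      assume w: "w \<in> ?W"
      then obtain t where "w = word t"
        using inchworm_imp_word by blast
      then show "w \<in> ?T"
        using w by (simp add: width_word kiss_word)
    qed (auto simp: width_word kiss_word inchworm_word)
    moreover have "inj_on word {t \<in> UNIV. weight t = n \<and> kisses t = k}"
      using bij_betw_imp_inj_on[OF bij_word] by (rule inj_on_subset) simp
    ultimately show ?thesis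
      by (simp add: card_image)
  qed
  then show ?thesis
    unfolding inchworm_gf_def gf_def by presburger
qed

theorem theorem9:
  shows "let x = (fps_X :: real fps fps); y = (fps_const fps_X :: real fps fps) in
    to_fract inchworm_gf =
      to_fract (1 - x^4 * y + x^4 * y^2
        - fps2_sqrt (1 - 2 * x^4 * y - 2 * x^4 * y^2 + x^8 * y^2 - 2 * x^8 * y^3 + x^8 * y^4))
      / to_fract (2 * x^4 * y^2)"
  unfolding Let_def inchworm_gf_eq
  by (rule closed_form_of_quadratic[OF refl refl tree_gf_UNIV])

end
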